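(* Let $\lambda\in X_*(T)\subset\mathfrak h_{\mathbb R}$ be a dominant coweight. Let $P\in\mathcal{MV}(\lambda)$ (resp., $P\in\mathcal{MV}(\infty)$), and let $x\in W^\lambda_{\min}$ (resp., $x\in W$). Then $P\in\overline{\mathcal{MV}}_x(\lambda)$ (resp., $P\in\overline{\mathcal{MV}}_x(\infty)$) if and only if for some (or equivalently, every) $\mathbf i\in R(w_0)$, the element $x$ is identical to the minimum element $\min W(P,\mathbf i)$ of $W(P,\mathbf i)$ with respect to the Bruhat ordering on $W$.
   Context: **Root data.** $G$ is a complex, connected, semisimple, simply-laced algebraic group with Lie algebra $\mathfrak g$, maximal torus $T$, Cartan subalgebra $\mathfrak h=\mathrm{Lie}(T)$, Cartan matrix $(a_{ij})_{i,j\in I}$ (off-diagonal entries $0$ or $-1$), simple roots $\alpha_j\in\mathfrak h^*$, simple coroots $h_j\in\mathfrak h$, $\langle\alpha_j,h_i\rangle=a_{ij}$, and $\mathfrak h_{\mathbb R}=\sum_{j\in I}\mathbb R h_j$. $W$ is the Weyl group with simple reflections $s_j$, length function $\ell$, unit $e$, longest element $w_0$, $m=\ell(w_0)$; $\le$ is the Bruhat order. $R(w_0)$ is the set of reduced words $\mathbf i=(i_1,\dots,i_m)$ for $w_0$; $w^{\mathbf i}_l:=s_{i_1}\cdots s_{i_l}$ for $0\le l\le m$. A coweight $\lambda\in X_*(T)=\mathrm{Hom}(\mathbb C^*,T)\subset\mathfrak h_{\mathbb R}$ is dominant if $\langle\alpha_j,\lambda\rangle\ge0$ for all $j$. $W_\lambda=\{w\in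 W\mid w\cdot\lambda=\lambda\}$, and $W^\lambda_{\min}$ is the set of minimal coset representatives for $W/W_\lambda$ with respect to the Bruhat order. **MV polytopes.** A GGMS datum is a family $\mu_\bullet=(\mu_w)_{w\in W}$ in $\mathfrak h_{\mathbb R}$ with $w^{-1}\cdot(\mu_{w'}-\mu_w)\in\sum_j\mathbb Z_{\ge0}h_j$ for all $w,w'\in W$. Its pseudo-Weyl polytope is $P(\mu_\bullet)=\{h\in\mathfrak h_{\mathbb R}\mid w^{-1}\cdot(h-\mu_w)\in\sum_j\mathbb R_{\ge0}h_j\ \forall w\in W\}=\mathrm{Conv}\{\mu_w\mid w\in W\}$; it determines $\mu_\bullet$. For $\mathbf i\in R(w_0)$ the integers $n^{\mathbf i}_l=n^{\mathbf i}_l(\mu_\bullet)\ge0$ ($1\le l\le m$) are defined by $\mu_{w^{\mathbf i}_l}-\mu_{w^{\mathbf i}_{l-1}}=n^{\mathbf i}_l\,w^{\mathbf i}_{l-1}\cdot h_{i_l}$. Words $\mathbf i,\mathbf j\in R(w_0)$ are related by a 2-move (at positions $k+1,k+2$) if they agree elsewhere and there have entries $(i,j)$, $(j,i)$ with $a_{ij}=0$; by a 3-move (at positions $k+1,k+2,k+3$) if they agree elsewhere and there have entries $(i,j,i)$, $(j,i,j)$ with $a_{ij}=a_{ji}=-1$. A GGMS datum is an MV datum if: for every 2-move, $n^{\mathbf i}_l=n^{\mathbf j}_l$ for $l\neq k+1,k+2$, $n^{\mathbf i}_{k+1}=n^{\mathbf j}_{k+2}$, $n^{\mathbf i}_{k+2}=n^{\mathbf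 j}_{k+1}$; for every 3-move, $n^{\mathbf i}_l=n^{\mathbf j}_l$ for $l\ne k+1,k+2,k+3$ and, with $M=\min(n^{\mathbf i}_{k+1},n^{\mathbf i}_{k+3})$, $n^{\mathbf j}_{k+1}=n^{\mathbf i}_{k+2}+n^{\mathbf i}_{k+3}-M$, $n^{\mathbf j}_{k+2}=M$, $n^{\mathbf j}_{k+3}=n^{\mathbf i}_{k+1}+n^{\mathbf i}_{k+2}-M$. An MV polytope is $P(\mu_\bullet)$ with $\mu_\bullet$ an MV datum. $\mathcal{MV}(\infty)$ is the set of MV polytopes $P(\mu_\bullet)$ with $\mu_{w_0}=0$; $\mathcal{MV}(\lambda)$ is the set of MV polytopes $P(\mu_\bullet)\subset\mathrm{Conv}(W\cdot\lambda)$ with $\mu_{w_0}=\lambda$. **Demazure crystals.** For $x\in W$, $p=\ell(xw_0)$ and $\mathbf i\in R(w_0)$, $S(xw_0,\mathbf i)$ is the set of $(a_1,\dots,a_p)$ with $1\le a_1<\cdots<a_p\le m$ and $s_{i_{a_1}}\cdots s_{i_{a_p}}=xw_0$. $\mathcal{MV}_x(\lambda)$ (resp. $\mathcal{MV}_x(\infty)$) is the set of $P(\mu_\bullet)\in\mathcal{MV}(\lambda)$ (resp. $\mathcal{MV}(\infty)$) such that for some $\mathbf i\in R(w_0)$ there exists $(a_1,\dots,a_p)\in S(xw_0,\mathbf i)$ with $n^{\mathbf i}_{a_q}(\mu_\bullet)=0$ for all $1\le q\le p$. (Under Kamnitzer's crystal isomorphisms these are the images of the Demazure crystals $\mathcal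 B_x(\lambda)$, $\mathcal B_x(\infty)$.) For $x\in W^\lambda_{\min}$ set $\overline{\mathcal{MV}}_x(\lambda)=\mathcal{MV}_x(\lambda)\setminus\bigcup_{z\in W^\lambda_{\min},\,z<x}\mathcal{MV}_z(\lambda)$; for $x\in W$ set $\overline{\mathcal{MV}}_x(\infty)=\mathcal{MV}_x(\infty)\setminus\bigcup_{z\in W,\,z<x}\mathcal{MV}_z(\infty)$. **The set $W(P,\mathbf i)$.** For $P=P(\mu_\bullet)$ in $\mathcal{MV}(\lambda)$ or $\mathcal{MV}(\infty)$ and $\mathbf i\in R(w_0)$, $T(P,\mathbf i)$ is the set of sequences $(a_1,\dots,a_l)$ with $0\le l\le m$, $1\le a_1<\cdots<a_l\le m$ and $n^{\mathbf i}_{a_q}(\mu_\bullet)=0$ for all $1\le q\le l$; and $W(P,\mathbf i)=\{s_{i_{a_1}}\cdots s_{i_{a_l}}w_0\mid(a_1,\dots,a_l)\in T(P,\mathbf i)\}\subset W$. (This set has a minimum in the Bruhat order.) *)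

theory Defs
  imports "HOL-Analysis.Analysis"
begin

text \<open>
  The group \<open>G\<close> enters only through its root datum: the Cartan matrix \<open>A\<close> and the coweight
  lattice \<open>X = X_*(T)\<close>.  The simple coroots form a basis of the real Cartan subalgebra, which is
  identified with \<^typ>\<open>real ^ 'i\<close> so that \<open>h_j\<close> is the \<open>j\<close>-th standard basis vector.  By the
  existence theorem for reductive groups, the lattices occurring as \<open>X_*(T)\<close> for a semisimple group
  with Cartan matrix \<open>A\<close> are exactly the groups between the coroot lattice and the coweight lattice.
\<close>

definition simply_laced_cartan :: "('i::finite \<Rightarrow> 'i \<Rightarrow> int) \<Rightarrow> bool" where
  "simply_laced_cartan A \<longleftrightarrow>
     (\<forall>i. A i i = 2) \<and>
     (\<forall>i j. i \<noteq> j \<longrightarrow> A i j \<in> {0, -1}) \<and>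
     (\<forall>i j. A i j = A j i) \<and>
     (\<forall>v :: real ^ 'i. v \<noteq> 0 \<longrightarrow> 0 < (\<Sum>i\<in>UNIV. \<Sum>j\<in>UNIV. real_of_int (A i j) * v $ i * v $ j))"

definition simple_coroot :: "'i::finite \<Rightarrow> real ^ 'i" where
  "simple_coroot j = axis j 1"

text \<open>\<open>simple_root A j h\<close> is the value of the simple root \<open>\<alpha>_j\<close> at \<open>h\<close>, so that
  \<open>simple_root A j (simple_coroot i) = A i j\<close>.\<close>

definition simple_root :: "('i::finite \<Rightarrow> 'i \<Rightarrow> int) \<Rightarrow> 'i \<Rightarrow> real ^ 'i \<Rightarrow> real" where
  "simple_root A j h = (\<Sum>i\<in>UNIV. real_of_int (A i j) * h $ i)"

definition simply_laced_root_datum ::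
    "('i::finite \<Rightarrow> 'i \<Rightarrow> int) \<Rightarrow> (real ^ 'i) set \<Rightarrow> bool" where
  "simply_laced_root_datum A X \<longleftrightarrow>
     simply_laced_cartan A \<and>
     0 \<in> X \<and> (\<forall>x\<in>X. \<forall>y\<in>X. x - y \<in> X) \<and>
     range simple_coroot \<subseteq> X \<and>
     (\<forall>x\<in>X. \<forall>j. simple_root A j x \<in> \<int>)"

definition dominant :: "('i::finite \<Rightarrow> 'i \<Rightarrow> int) \<Rightarrow> real ^ 'i \<Rightarrow> bool" where
  "dominant A lam \<longleftrightarrow> (\<forall>j. 0 \<le> simple_root A j lam)"


section \<open>Weyl group\<close>

definition simple_refl :: "('i::finite \<Rightarrow> 'i \<Rightarrow> int) \<Rightarrow> 'i \<Rightarrow> real ^ 'i \<Rightarrow> real ^ 'i" where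
  "simple_refl A j h = h - simple_root A j h *\<^sub>R simple_coroot j"

definition word_prod :: "('i::finite \<Rightarrow> 'i \<Rightarrow> int) \<Rightarrow> 'i list \<Rightarrow> real ^ 'i \<Rightarrow> real ^ 'i" where
  "word_prod A ii = foldr (\<lambda>j w. simple_refl A j \<circ> w) ii id"

text \<open>The simple reflections are involutions, so products of them already form a group.\<close>

definition weyl :: "('i::finite \<Rightarrow> 'i \<Rightarrow> int) \<Rightarrow> (real ^ 'i \<Rightarrow> real ^ 'i) set" where
  "weyl A = range (word_prod A)"

definition len :: "('i::finite \<Rightarrow> 'i \<Rightarrow> int) \<Rightarrow> (real ^ 'i \<Rightarrow> real ^ 'i) \<Rightarrow> nat" where
  "len A w = (LEAST n. \<exists>ii. length ii = n \<and> word_prod A ii = w)"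

definition longest :: "('i::finite \<Rightarrow> 'i \<Rightarrow> int) \<Rightarrow> real ^ 'i \<Rightarrow> real ^ 'i" where
  "longest A = arg_max_on (len A) (weyl A)"

definition reduced_words ::
    "('i::finite \<Rightarrow> 'i \<Rightarrow> int) \<Rightarrow> (real ^ 'i \<Rightarrow> real ^ 'i) \<Rightarrow> 'i list set" where
  "reduced_words A w = {ii. word_prod A ii = w \<and> length ii = len A w}"

definition reflections :: "('i::finite \<Rightarrow> 'i \<Rightarrow> int) \<Rightarrow> (real ^ 'i \<Rightarrow> real ^ 'i) set" where
  "reflections A = {w \<circ> simple_refl A j \<circ> inv w | w j. w \<in> weyl A}"

definition bruhat_le ::
    "('i::finite \<Rightarrow> 'i \<Rightarrow> int) \<Rightarrow> (real ^ 'i \<Rightarrow> real ^ 'i) \<Rightarrow> (real ^ 'i \<Rightarrow> real ^ 'i) \<Rightarrow> bool" where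
  "bruhat_le A u v \<longleftrightarrow>
     (u, v) \<in> {(y, z). y \<in> weyl A \<and> (\<exists>t\<in>reflections A. z = y \<circ> t) \<and> len A y < len A z}\<^sup>*"

definition bruhat_less ::
    "('i::finite \<Rightarrow> 'i \<Rightarrow> int) \<Rightarrow> (real ^ 'i \<Rightarrow> real ^ 'i) \<Rightarrow> (real ^ 'i \<Rightarrow> real ^ 'i) \<Rightarrow> bool" where
  "bruhat_less A u v \<longleftrightarrow> bruhat_le A u v \<and> u \<noteq> v"

definition is_bruhat_minimum ::
    "('i::finite \<Rightarrow> 'i \<Rightarrow> int) \<Rightarrow> (real ^ 'i \<Rightarrow> real ^ 'i) set \<Rightarrow> (real ^ 'i \<Rightarrow> real ^ 'i) \<Rightarrow> bool" where
  "is_bruhat_minimum A S x \<longleftrightarrow> x \<in> S \<and> (\<forall>y\<in>S. bruhat_le A x y)"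

definition stabilizer ::
    "('i::finite \<Rightarrow> 'i \<Rightarrow> int) \<Rightarrow> real ^ 'i \<Rightarrow> (real ^ 'i \<Rightarrow> real ^ 'i) set" where
  "stabilizer A lam = {w \<in> weyl A. w lam = lam}"

definition min_coset_reps ::
    "('i::finite \<Rightarrow> 'i \<Rightarrow> int) \<Rightarrow> real ^ 'i \<Rightarrow> (real ^ 'i \<Rightarrow> real ^ 'i) set" where
  "min_coset_reps A lam = {w \<in> weyl A. \<forall>u\<in>stabilizer A lam. \<not> bruhat_less A (w \<circ> u) w}"


section \<open>MV polytopes\<close>

text \<open>Families indexed by the Weyl group are total functions; only their values on
  \<^term>\<open>weyl A\<close> matter.\<close>

definition ggms_datum ::
    "('i::finite \<Rightarrow> 'i \<Rightarrow> int) \<Rightarrow> ((real ^ 'i \<Rightarrow> real ^ 'i) \<Rightarrow> real ^ 'i) \<Rightarrow> bool" where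
  "ggms_datum A \<mu> \<longleftrightarrow>
     (\<forall>w\<in>weyl A. \<forall>w'\<in>weyl A. \<exists>c :: 'i \<Rightarrow> nat.
        inv w (\<mu> w' - \<mu> w) = (\<Sum>j\<in>UNIV. real (c j) *\<^sub>R simple_coroot j))"

definition pseudo_weyl_polytope ::
    "('i::finite \<Rightarrow> 'i \<Rightarrow> int) \<Rightarrow> ((real ^ 'i \<Rightarrow> real ^ 'i) \<Rightarrow> real ^ 'i) \<Rightarrow> (real ^ 'i) set" where
  "pseudo_weyl_polytope A \<mu> =
     {h. \<forall>w\<in>weyl A. \<exists>c :: 'i \<Rightarrow> real. (\<forall>j. 0 \<le> c j) \<and>
        inv w (h - \<mu> w) = (\<Sum>j\<in>UNIV. c j *\<^sub>R simple_coroot j)}"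

text \<open>Positions in words are counted from 1, list indices from 0.\<close>

definition edge_length ::
    "('i::finite \<Rightarrow> 'i \<Rightarrow> int) \<Rightarrow> ((real ^ 'i \<Rightarrow> real ^ 'i) \<Rightarrow> real ^ 'i) \<Rightarrow> 'i list \<Rightarrow> nat \<Rightarrow> nat" where
  "edge_length A \<mu> ii l =
     (THE n. \<mu> (word_prod A (take l ii)) - \<mu> (word_prod A (take (l - 1) ii)) =
             real n *\<^sub>R word_prod A (take (l - 1) ii) (simple_coroot (ii ! (l - 1))))"

definition two_move :: "('i::finite \<Rightarrow> 'i \<Rightarrow> int) \<Rightarrow> nat \<Rightarrow> 'i list \<Rightarrow> 'i list \<Rightarrow> bool" where
  "two_move A k ii jj \<longleftrightarrow>
     (\<exists>p q i j. length p = k \<and> A i j = 0 \<and>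
        ii = p @ [i, j] @ q \<and> jj = p @ [j, i] @ q)"

definition three_move :: "('i::finite \<Rightarrow> 'i \<Rightarrow> int) \<Rightarrow> nat \<Rightarrow> 'i list \<Rightarrow> 'i list \<Rightarrow> bool" where
  "three_move A k ii jj \<longleftrightarrow>
     (\<exists>p q i j. length p = k \<and> A i j = -1 \<and> A j i = -1 \<and>
        ii = p @ [i, j, i] @ q \<and> jj = p @ [j, i, j] @ q)"

definition mv_datum ::
    "('i::finite \<Rightarrow> 'i \<Rightarrow> int) \<Rightarrow> ((real ^ 'i \<Rightarrow> real ^ 'i) \<Rightarrow> real ^ 'i) \<Rightarrow> bool" where
  "mv_datum A \<mu> \<longleftrightarrow> ggms_datum A \<mu> \<and>
     (\<forall>ii\<in>reduced_words A (longest A). \<forall>jj\<in>reduced_words A (longest A). \<forall>k.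
        let n = edge_length A \<mu> ii; n' = edge_length A \<mu> jj in
        (two_move A k ii jj \<longrightarrow>
           (\<forall>l\<in>{1..length ii} - {k+1, k+2}. n l = n' l) \<and>
           n (k+1) = n' (k+2) \<and> n (k+2) = n' (k+1)) \<and>
        (three_move A k ii jj \<longrightarrow>
           (\<forall>l\<in>{1..length ii} - {k+1, k+2, k+3}. n l = n' l) \<and>
           (let M = min (n (k+1)) (n (k+3)) in
              n' (k+1) = n (k+2) + n (k+3) - M \<and>
              n' (k+2) = M \<and>
              n' (k+3) = n (k+1) + n (k+2) - M)))"

definition MV_inf :: "('i::finite \<Rightarrow> 'i \<Rightarrow> int) \<Rightarrow> (real ^ 'i) set set" where
  "MV_inf A = {pseudo_weyl_polytope A \<mu> | \<mu>. mv_datum A \<mu> \<and> \<mu> (longest A) = 0}"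

definition MV :: "('i::finite \<Rightarrow> 'i \<Rightarrow> int) \<Rightarrow> real ^ 'i \<Rightarrow> (real ^ 'i) set set" where
  "MV A lam = {pseudo_weyl_polytope A \<mu> | \<mu>. mv_datum A \<mu> \<and> \<mu> (longest A) = lam \<and>
     pseudo_weyl_polytope A \<mu> \<subseteq> convex hull {w lam | w. w \<in> weyl A}}"

text \<open>The polytope of a GGMS datum determines the datum on \<^term>\<open>weyl A\<close>, so every choice
  below has the same values there.\<close>

definition datum_of ::
    "('i::finite \<Rightarrow> 'i \<Rightarrow> int) \<Rightarrow> (real ^ 'i) set \<Rightarrow> (real ^ 'i \<Rightarrow> real ^ 'i) \<Rightarrow> real ^ 'i" where
  "datum_of A P = (SOME \<mu>. ggms_datum A \<mu> \<and> pseudo_weyl_polytope A \<mu> = P)"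


section \<open>Demazure crystals\<close>

definition position_seqs :: "'i list \<Rightarrow> nat list set" where
  "position_seqs ii = {as. sorted_wrt (<) as \<and> set as \<subseteq> {1..length ii}}"

definition subword :: "'i list \<Rightarrow> nat list \<Rightarrow> 'i list" where
  "subword ii as = map (\<lambda>a. ii ! (a - 1)) as"

definition S_seqs ::
    "('i::finite \<Rightarrow> 'i \<Rightarrow> int) \<Rightarrow> (real ^ 'i \<Rightarrow> real ^ 'i) \<Rightarrow> 'i list \<Rightarrow> nat list set" where
  "S_seqs A w ii =
     {as \<in> position_seqs ii. length as = len A w \<and> word_prod A (subword ii as) = w}"

definition T_seqs :: "('i::finite \<Rightarrow> 'i \<Rightarrow> int) \<Rightarrow> (real ^ 'i) set \<Rightarrow> 'i list \<Rightarrow> nat list set" where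
  "T_seqs A P ii =
     {as \<in> position_seqs ii. \<forall>a\<in>set as. edge_length A (datum_of A P) ii a = 0}"

definition demazure_cond ::
    "('i::finite \<Rightarrow> 'i \<Rightarrow> int) \<Rightarrow> (real ^ 'i \<Rightarrow> real ^ 'i) \<Rightarrow> (real ^ 'i) set \<Rightarrow> bool" where
  "demazure_cond A x P \<longleftrightarrow>
     (\<exists>ii\<in>reduced_words A (longest A). \<exists>as\<in>S_seqs A (x \<circ> longest A) ii.
        \<forall>a\<in>set as. edge_length A (datum_of A P) ii a = 0)"

definition MV_dem ::
    "('i::finite \<Rightarrow> 'i \<Rightarrow> int) \<Rightarrow> (real ^ 'i \<Rightarrow> real ^ 'i) \<Rightarrow> real ^ 'i \<Rightarrow> (real ^ 'i) set set" where
  "MV_dem A x lam = {P \<in> MV A lam. demazure_cond A x P}"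

definition MV_inf_dem ::
    "('i::finite \<Rightarrow> 'i \<Rightarrow> int) \<Rightarrow> (real ^ 'i \<Rightarrow> real ^ 'i) \<Rightarrow> (real ^ 'i) set set" where
  "MV_inf_dem A x = {P \<in> MV_inf A. demazure_cond A x P}"

definition MV_bar ::
    "('i::finite \<Rightarrow> 'i \<Rightarrow> int) \<Rightarrow> (real ^ 'i \<Rightarrow> real ^ 'i) \<Rightarrow> real ^ 'i \<Rightarrow> (real ^ 'i) set set" where
  "MV_bar A x lam =
     MV_dem A x lam - (\<Union>z\<in>{z \<in> min_coset_reps A lam. bruhat_less A z x}. MV_dem A z lam)"

definition MV_inf_bar ::
    "('i::finite \<Rightarrow> 'i \<Rightarrow> int) \<Rightarrow> (real ^ 'i \<Rightarrow> real ^ 'i) \<Rightarrow> (real ^ 'i) set set" where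
  "MV_inf_bar A x =
     MV_inf_dem A x - (\<Union>z\<in>{z \<in> weyl A. bruhat_less A z x}. MV_inf_dem A z)"

definition W_set ::
    "('i::finite \<Rightarrow> 'i \<Rightarrow> int) \<Rightarrow> (real ^ 'i) set \<Rightarrow> 'i list \<Rightarrow> (real ^ 'i \<Rightarrow> real ^ 'i) set" where
  "W_set A P ii = {word_prod A (subword ii as) \<circ> longest A | as. as \<in> T_seqs A P ii}"

end

theory Submission
  imports Defs "HOL-Library.Sublist"
begin

text \<open>
  Fix an MV datum and a reduced word \<open>ii\<close> of the longest element \<open>w0\<close>, and keep only the letters of
  \<open>ii\<close> whose edge has length 0.  Let \<open>V(ii)\<close> be the set of products of subwords of the remaining word,
  so that \<open>W(P, ii) = V(ii) w0\<close>.  Three facts give the theorem.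

  \<^item> For every word, reduced or not, the subword products are exactly the elements below some \<open>d\<close> in the
  Bruhat order (\<open>subword_prods_max\<close>); \<open>d\<close> is the Demazure (0-Hecke) product of the letters.  This is
  an induction on the word using the lifting property.  Multiplication by \<open>w0\<close> reverses
  the Bruhat order (\<open>bruhat_reverse\<close>), so \<open>W(P, ii)\<close> has the minimum \<open>y = d w0\<close>.

  \<^item> \<open>V(ii)\<close> is the same for all \<open>ii\<close> (\<open>zero_prods_max\<close>).  Any two reduced words are connected by braid
  moves (\<open>matsumoto\<close>).  For a 3-move, the tropical relations between the edge lengths change the set
  of vanishing positions in such a way that the subword products of the vanishing letters do not change
  (\<open>braid_step_zero_prods\<close>): for instance, if only the middle edge of \<open>(i,j,i)\<close> vanishes, then
  in \<open>(j,i,j)\<close> one or both letters \<open>j\<close> survive.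

  \<^item> Since \<open>V(ii)\<close> does not depend on \<open>ii\<close>, the polytope lies in the Demazure crystal of \<open>x\<close> if and only
  if \<open>x w0 \<le> d\<close>, that is, \<open>y \<le> x\<close>.  Removing the Demazure crystals of smaller elements leaves \<open>x = y\<close>,
  provided that \<open>y\<close> itself is an admissible index.

  In the case of a coweight \<open>\<lambda>\<close> the last proviso says that \<open>y\<close> is a minimal coset representative
  (\<open>minimum_in_min_coset_reps\<close>), and this is where the inclusion of \<open>P\<close> in the convex hull of the orbit
  of \<open>\<lambda>\<close> enters.  If \<open>\<langle>\<alpha>_j, \<lambda>\<rangle> = 0\<close>, choose \<open>ii\<close> so that its last edge starts at the vertex \<open>\<lambda> - n h_j\<close>.
  This vertex has squared norm \<open>|\<lambda>|\<^sup>2 + 2 n\<^sup>2\<close> for the invariant form, whereas the hull lies in the ball of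
  radius \<open>|\<lambda>|\<close>; hence \<open>n = 0\<close>, the last letter belongs to the vanishing letters, and \<open>y h_j\<close>
  is positive.

  The Coxeter theory needed for this (exchange, deletion, Bruhat order, braid connectivity) is derived
  from the geometry of the roots: length goes up under a reflection exactly when the corresponding positive
  root stays positive (\<open>len_reflect_iff\<close>).
\<close>

section \<open>The invariant form and its roots\<close>

definition cartan_form :: "('i::finite \<Rightarrow> 'i \<Rightarrow> int) \<Rightarrow> real ^ 'i \<Rightarrow> real ^ 'i \<Rightarrow> real" where
  "cartan_form A u v = (\<Sum>i\<in>UNIV. \<Sum>j\<in>UNIV. real_of_int (A i j) * u $ i * v $ j)"

lemma cartan_form_add_left: "cartan_form A (u + u') v = cartan_form A u v + cartan_form A u' v"
  by (simp add: cartan_form_def algebra_simps sum.distrib)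

lemma cartan_form_add_right: "cartan_form A u (v + v') = cartan_form A u v + cartan_form A u v'"
  by (simp add: cartan_form_def algebra_simps sum.distrib)

lemma cartan_form_scaleR_left: "cartan_form A (c *\<^sub>R u) v = c * cartan_form A u v"
  by (simp add: cartan_form_def sum_distrib_left algebra_simps)

lemma cartan_form_scaleR_right: "cartan_form A u (c *\<^sub>R v) = c * cartan_form A u v"
  by (simp add: cartan_form_def sum_distrib_left algebra_simps)

lemma cartan_form_minus_left: "cartan_form A (- u) v = - cartan_form A u v"
  using cartan_form_scaleR_left[of A "-1" u v] by simp

lemma cartan_form_minus_right: "cartan_form A u (- v) = - cartan_form A u v"
  using cartan_form_scaleR_right[of A u "-1" v] by simp

lemma cartan_form_diff_left: "cartan_form A (u - u') v = cartan_form A u v - cartan_form A u' v"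
  using cartan_form_add_left[of A u "- u'" v] by (simp add: cartan_form_minus_left)

lemma cartan_form_diff_right: "cartan_form A u (v - v') = cartan_form A u v - cartan_form A u v'"
  using cartan_form_add_right[of A u v "- v'"] by (simp add: cartan_form_minus_right)

lemmas cartan_form_bilinear =
  cartan_form_add_left cartan_form_add_right cartan_form_scaleR_left cartan_form_scaleR_right
  cartan_form_minus_left cartan_form_minus_right cartan_form_diff_left cartan_form_diff_right

lemma cartan_form_axis_left: "cartan_form A (axis j 1) v = (\<Sum>i\<in>UNIV. real_of_int (A j i) * v $ i)"
proof -
  have "cartan_form A (axis j 1) v
      = (\<Sum>i\<in>UNIV. if i = j then (\<Sum>k\<in>UNIV. real_of_int (A j k) * v $ k) else 0)"
    unfolding cartan_form_def by (intro sum.cong) (auto simp: axis_def)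
  then show ?thesis by simp
qed

lemma cartan_form_axis: "cartan_form A (axis i 1) (axis j 1) = real_of_int (A i j)"
  by (simp add: cartan_form_axis_left) (simp add: axis_def if_distrib cong: if_cong)

lemma cartan_form_expand_left:
  "cartan_form A u v = (\<Sum>i\<in>UNIV. u $ i * cartan_form A (axis i 1) v)"
  unfolding cartan_form_axis_left by (simp add: cartan_form_def sum_distrib_left algebra_simps)

definition integral_vec :: "real ^ 'i::finite \<Rightarrow> bool" where
  "integral_vec v \<longleftrightarrow> (\<forall>i. v $ i \<in> \<int>)"

definition nonneg_vec :: "real ^ 'i::finite \<Rightarrow> bool" where
  "nonneg_vec v \<longleftrightarrow> (\<forall>i. 0 \<le> v $ i)"

text \<open>
  In the simply-laced case the roots, identified with the coroots through the form, are the vectors of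
  squared norm 2 in the lattice spanned by the simple ones.  Taking this as the definition makes
  invariance under the Weyl group immediate.
\<close>
definition root_vec :: "('i::finite \<Rightarrow> 'i \<Rightarrow> int) \<Rightarrow> real ^ 'i \<Rightarrow> bool" where
  "root_vec A v \<longleftrightarrow> integral_vec v \<and> cartan_form A v v = 2"

definition reflect :: "('i::finite \<Rightarrow> 'i \<Rightarrow> int) \<Rightarrow> real ^ 'i \<Rightarrow> real ^ 'i \<Rightarrow> real ^ 'i" where
  "reflect A b h = h - cartan_form A b h *\<^sub>R b"

lemma nonneg_vec_antisym: "nonneg_vec v \<Longrightarrow> nonneg_vec (- v) \<Longrightarrow> v = 0"
  unfolding nonneg_vec_def vec_eq_iff by (auto intro: antisym)

lemma nonneg_vec_add: "nonneg_vec u \<Longrightarrow> nonneg_vec v \<Longrightarrow> nonneg_vec (u + v)"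
  by (simp add: nonneg_vec_def)

lemma reflect_minus: "reflect A (- b) = reflect A b"
  by (rule ext) (simp add: reflect_def cartan_form_bilinear)

locale simply_laced =
  fixes A :: "'i::finite \<Rightarrow> 'i \<Rightarrow> int"
  assumes cartan: "simply_laced_cartan A"
begin

abbreviation form (infixl "\<bullet>\<^sub>A" 70) where "u \<bullet>\<^sub>A v \<equiv> cartan_form A u v"
abbreviation refl where "refl \<equiv> simple_refl A"
abbreviation alpha :: "'i \<Rightarrow> real ^ 'i" where "alpha j \<equiv> axis j 1"

lemma diag: "A i i = 2" and off_diag: "i \<noteq> j \<Longrightarrow> A i j = 0 \<or> A i j = -1" and sym: "A i j = A j i"
  using cartan unfolding simply_laced_cartan_def by auto

lemma form_pos: "v \<noteq> 0 \<Longrightarrow> 0 < v \<bullet>\<^sub>A v"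
  using cartan unfolding simply_laced_cartan_def cartan_form_def by auto

lemma form_commute: "u \<bullet>\<^sub>A v = v \<bullet>\<^sub>A u"
proof -
  have "u \<bullet>\<^sub>A v = (\<Sum>j\<in>UNIV. \<Sum>i\<in>UNIV. real_of_int (A i j) * u $ i * v $ j)"
    unfolding cartan_form_def by (rule sum.swap)
  also have "\<dots> = v \<bullet>\<^sub>A u"
    unfolding cartan_form_def by (intro sum.cong refl) (simp add: sym[of _ ] mult.commute mult.left_commute)
  finally show ?thesis .
qed

lemma simple_root_eq_form: "simple_root A j h = alpha j \<bullet>\<^sub>A h"
  unfolding simple_root_def cartan_form_axis_left by (simp add: sym[of j])

lemma simple_refl_eq_reflect: "refl j = reflect A (alpha j)"
  by (rule ext) (simp add: simple_refl_def reflect_def simple_root_eq_form simple_coroot_def)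

lemma root_alpha: "root_vec A (alpha j)" "nonneg_vec (alpha j)"
  by (auto simp: root_vec_def cartan_form_axis diag) (auto simp: integral_vec_def nonneg_vec_def axis_def)

lemma root_minus: "root_vec A (- v) \<longleftrightarrow> root_vec A v"
  by (simp add: root_vec_def integral_vec_def cartan_form_bilinear)

lemma root_nonzero: "root_vec A v \<Longrightarrow> v \<noteq> 0"
  by (auto simp: root_vec_def cartan_form_def)

text \<open>
  The diagonal of the Cartan matrix is even and each off-diagonal entry occurs twice by symmetry.
\<close>
lemma even_form: 
  assumes "integral_vec v"
  shows "\<exists>k::int. v \<bullet>\<^sub>A v = 2 * real_of_int k"
proof -
  define f where "f i = \<lfloor>v $ i\<rfloor>" for i
  have v: "v $ i = real_of_int (f i)" for i
    using assms unfolding integral_vec_def f_def by (metis Ints_cases floor_of_int)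
  have "even (\<Sum>i\<in>I. \<Sum>j\<in>I. A i j * f i * f j)" if "finite I" for I :: "'i set"
    using that
  proof (induction I)
    case (insert x I)
    have "(\<Sum>i\<in>insert x I. \<Sum>j\<in>insert x I. A i j * f i * f j)
        = A x x * f x * f x + (\<Sum>j\<in>I. A x j * f x * f j) + (\<Sum>i\<in>I. A i x * f i * f x)
          + (\<Sum>i\<in>I. \<Sum>j\<in>I. A i j * f i * f j)"
      using insert.hyps by (simp add: sum.distrib)
    also have "(\<Sum>i\<in>I. A i x * f i * f x) = (\<Sum>j\<in>I. A x j * f x * f j)"
      by (intro sum.cong HOL.refl) (simp add: sym[of _ x])
    finally show ?case using insert.IH by (simp add: diag)
  qed simp
  then obtain k where k: "(\<Sum>i\<in>UNIV. \<Sum>j\<in>UNIV. A i j * f i * f j) = 2 * k" by (meson evenE finite)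
  have "v \<bullet>\<^sub>A v = real_of_int (\<Sum>i\<in>UNIV. \<Sum>j\<in>UNIV. A i j * f i * f j)"
    unfolding cartan_form_def by (simp add: v)
  then show ?thesis using k by auto
qed

text \<open>
  Write \<open>v = p - q\<close> with nonnegative \<open>p\<close> and \<open>q\<close> of disjoint support.  As off-diagonal entries are at most 0,
  \<open>v \<bullet> v \<ge> p \<bullet> p + q \<bullet> q\<close>.  The form takes positive even values on nonzero integral vectors, so if both parts
  were nonzero the right-hand side would be at least 4.
\<close>
lemma root_nonneg_or_nonpos:
  assumes "root_vec A v"
  shows "nonneg_vec v \<or> nonneg_vec (- v)"
proof (rule ccontr)
  assume neither: "\<not> ?thesis"
  define p q :: "real ^ 'i" where "p = (\<chi> i. max (v $ i) 0)" and "q = (\<chi> i. max (- v $ i) 0)"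
  have v: "v = p - q" by (simp add: vec_eq_iff p_def q_def max_def)
  have int: "integral_vec p" "integral_vec q"
    using assms by (auto simp: root_vec_def integral_vec_def p_def q_def max_def)
  have "p \<noteq> 0" "q \<noteq> 0"
    using neither by (auto simp: vec_eq_iff nonneg_vec_def p_def q_def max_def not_le split: if_splits)
  then have "0 < p \<bullet>\<^sub>A p" "0 < q \<bullet>\<^sub>A q" by (auto intro: form_pos)
  moreover obtain k l where "p \<bullet>\<^sub>A p = 2 * real_of_int k" "q \<bullet>\<^sub>A q = 2 * real_of_int l"
    using even_form int by blast
  ultimately have big: "p \<bullet>\<^sub>A p \<ge> 2" "q \<bullet>\<^sub>A q \<ge> 2" by auto
  have "real_of_int (A i j) * p $ i * q $ j \<le> 0" for i j
  proof (cases "i = j")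
    case True then show ?thesis by (simp add: p_def q_def max_def)
  next
    case False
    have "0 \<le> p $ i" "0 \<le> q $ j" by (auto simp: p_def q_def)
    then show ?thesis using off_diag[OF False] by auto
  qed
  then have "p \<bullet>\<^sub>A q \<le> 0" unfolding cartan_form_def by (intro sum_nonpos) auto
  then have "v \<bullet>\<^sub>A v \<ge> 4"
    using big form_commute[of p q] by (simp add: v cartan_form_bilinear)
  then show False using assms by (simp add: root_vec_def)
qed

lemma root_sign: "root_vec A v \<Longrightarrow> nonneg_vec (- v) \<longleftrightarrow> \<not> nonneg_vec v"
  using root_nonneg_or_nonpos nonneg_vec_antisym root_nonzero by blast

lemma reflect_reflect: "root_vec A b \<Longrightarrow> reflect A b (reflect A b h) = h"
  by (simp add: reflect_def cartan_form_bilinear root_vec_def)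

lemma reflect_form: "root_vec A b \<Longrightarrow> reflect A b u \<bullet>\<^sub>A reflect A b v = u \<bullet>\<^sub>A v"
  using form_commute[of u b] by (simp add: reflect_def cartan_form_bilinear root_vec_def algebra_simps)

lemma reflect_self: "root_vec A b \<Longrightarrow> reflect A b b = - b"
  by (simp add: reflect_def root_vec_def scaleR_2)

lemma linear_reflect: "linear (reflect A b)"
  by (rule linearI) (simp_all add: reflect_def cartan_form_bilinear algebra_simps)

lemma refl_coord: "i \<noteq> j \<Longrightarrow> refl j h $ i = h $ i"
  by (simp add: simple_refl_def simple_coroot_def axis_def)

lemma refl_refl [simp]: "refl j (refl j h) = h"
  by (simp add: simple_refl_eq_reflect reflect_reflect root_alpha)

lemma refl_comp_refl [simp]: "refl j \<circ> refl j = id"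
  by auto

lemma integral_form: "integral_vec u \<Longrightarrow> integral_vec v \<Longrightarrow> u \<bullet>\<^sub>A v \<in> \<int>"
  unfolding cartan_form_def integral_vec_def by (intro Ints_sum Ints_mult) auto

lemma root_reflect: "root_vec A b \<Longrightarrow> root_vec A v \<Longrightarrow> root_vec A (reflect A b v)"
  using integral_form[of b v] reflect_form[of b v v]
  by (auto simp: root_vec_def integral_vec_def reflect_def)

text \<open>
  A positive root other than \<open>alpha j\<close> has a positive coordinate away from \<open>j\<close>, which \<open>s_j\<close> leaves alone;
  one positive coordinate determines the sign of a root.
\<close>
lemma refl_nonneg:
  assumes "root_vec A v" "nonneg_vec v" "v \<noteq> alpha j"
  shows "nonneg_vec (refl j v)"
proof -
  have "\<exists>i. i \<noteq> j \<and> v $ i \<noteq> 0"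
  proof (rule ccontr)
    assume "\<not> ?thesis"
    then have v: "v = v $ j *\<^sub>R alpha j" by (auto simp: vec_eq_iff axis_def)
    have "v \<bullet>\<^sub>A v = v $ j * (v $ j * 2)"
      by (subst (1 2) v) (simp add: cartan_form_bilinear cartan_form_axis diag)
    then have "(v $ j)\<^sup>2 = 1" using assms(1) by (simp add: root_vec_def power2_eq_square)
    then have "v $ j = 1" using assms(2) by (auto simp: power2_eq_1_iff nonneg_vec_def dest: spec[of _ j])
    then show False using v assms(3) by simp
  qed
  then obtain i where i: "i \<noteq> j" "v $ i \<noteq> 0" by blast
  then have "0 < refl j v $ i" using assms(2) by (simp add: refl_coord nonneg_vec_def order.strict_iff_order)
  then have "\<not> nonneg_vec (- refl j v)" by (auto simp: nonneg_vec_def not_le intro!: exI[of _ i])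
  then show ?thesis using root_nonneg_or_nonpos root_reflect[OF root_alpha(1) assms(1)]
    by (auto simp: simple_refl_eq_reflect)
qed

section \<open>The Weyl group\<close>

lemma word_prod_Nil [simp]: "word_prod A [] = id"
  and word_prod_Cons [simp]: "word_prod A (j # q) = refl j \<circ> word_prod A q"
  by (simp_all add: word_prod_def)

lemma word_prod_append [simp]: "word_prod A (p @ q) = word_prod A p \<circ> word_prod A q"
  by (induction p) auto

lemma word_prod_rev: "word_prod A q \<circ> word_prod A (rev q) = id"
  by (induction q) (auto simp: fun_eq_iff)

lemma weyl_word: "word_prod A q \<in> weyl A" by (simp add: weyl_def)

lemma weyl_id: "id \<in> weyl A" using weyl_word[of "[]"] by simp

lemma weyl_refl: "refl j \<in> weyl A" using weyl_word[of "[j]"] by simp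

lemma weyl_comp: "u \<in> weyl A \<Longrightarrow> v \<in> weyl A \<Longrightarrow> u \<circ> v \<in> weyl A"
  unfolding weyl_def by (auto simp flip: word_prod_append)

lemma inv_word: "inv (word_prod A q) = word_prod A (rev q)"
  using word_prod_rev[of q] word_prod_rev[of "rev q"] by (intro inv_unique_comp) auto

lemma weyl_inv: "w \<in> weyl A \<Longrightarrow> inv w \<in> weyl A"
  unfolding weyl_def by (auto simp: inv_word)

lemma weyl_bij: "w \<in> weyl A \<Longrightarrow> bij w"
  unfolding weyl_def using word_prod_rev word_prod_rev[of "rev _"] by (auto intro: o_bij)

lemma weyl_inv_comp: "w \<in> weyl A \<Longrightarrow> inv w \<circ> w = id" "w \<in> weyl A \<Longrightarrow> w \<circ> inv w = id"
  using weyl_bij[of w] by (simp_all add: bij_is_inj bij_is_surj flip: surj_iff inj_iff)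

lemma weyl_inv_app [simp]: "w \<in> weyl A \<Longrightarrow> inv w (w h) = h" "w \<in> weyl A \<Longrightarrow> w (inv w h) = h"
  using weyl_inv_comp by (auto simp: fun_eq_iff)

lemma weyl_linear: "w \<in> weyl A \<Longrightarrow> linear w"
proof -
  have "linear (word_prod A q)" for q
    by (induction q) (simp_all only: word_prod_Nil word_prod_Cons simple_refl_eq_reflect linear_id
        linear_compose linear_reflect)
  then show "w \<in> weyl A \<Longrightarrow> linear w" by (auto simp: weyl_def)
qed

lemma weyl_form: "w \<in> weyl A \<Longrightarrow> w u \<bullet>\<^sub>A w v = u \<bullet>\<^sub>A v"
proof -
  have "word_prod A q u \<bullet>\<^sub>A word_prod A q v = u \<bullet>\<^sub>A v" for q
    by (induction q) (auto simp: simple_refl_eq_reflect reflect_form root_alpha)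
  then show "w \<in> weyl A \<Longrightarrow> ?thesis" by (auto simp: weyl_def)
qed

lemma weyl_root: "w \<in> weyl A \<Longrightarrow> root_vec A v \<Longrightarrow> root_vec A (w v)"
proof -
  have "root_vec A v \<Longrightarrow> root_vec A (word_prod A q v)" for q
    by (induction q) (auto simp: simple_refl_eq_reflect root_reflect root_alpha)
  then show "w \<in> weyl A \<Longrightarrow> root_vec A v \<Longrightarrow> ?thesis" by (auto simp: weyl_def)
qed

lemma weyl_minus: "w \<in> weyl A \<Longrightarrow> w (- v) = - w v"
  by (simp add: weyl_linear linear_neg)

lemma weyl_reflect: "w \<in> weyl A \<Longrightarrow> w \<circ> reflect A b = reflect A (w b) \<circ> w"
  by (rule ext) (simp add: reflect_def weyl_form weyl_linear linear_diff linear_scale)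

lemma conj_reflect: "w \<in> weyl A \<Longrightarrow> w \<circ> reflect A b \<circ> inv w = reflect A (w b)"
  by (simp add: weyl_reflect comp_assoc weyl_inv_comp)

lemma reflections_cases:
  assumes "t \<in> reflections A"
  obtains b where "root_vec A b" "nonneg_vec b" "t = reflect A b" "t \<in> weyl A"
proof -
  obtain w j where w: "w \<in> weyl A" and t: "t = w \<circ> refl j \<circ> inv w"
    using assms by (auto simp: reflections_def)
  have "t = reflect A (w (alpha j))" using conj_reflect[OF w] t by (simp add: simple_refl_eq_reflect)
  moreover have "root_vec A (w (alpha j))" by (simp add: weyl_root w root_alpha)
  moreover have "t \<in> weyl A" unfolding t by (intro weyl_comp w weyl_inv weyl_refl)
  ultimately show thesis
    using that root_nonneg_or_nonpos reflect_minus root_minus by metis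
qed

lemma reflections_refl: "refl j \<in> reflections A"
  unfolding reflections_def using weyl_id by (auto intro!: exI[of _ id])

lemma reflections_conj:
  assumes "t \<in> reflections A" "u \<in> weyl A"
  shows "u \<circ> t \<circ> inv u \<in> reflections A"
proof -
  obtain w j where w: "w \<in> weyl A" and t: "t = w \<circ> refl j \<circ> inv w"
    using assms by (auto simp: reflections_def)
  have "u \<circ> t \<circ> inv u = (u \<circ> w) \<circ> refl j \<circ> inv (u \<circ> w)"
    using t w assms(2) by (simp add: o_inv_distrib weyl_bij comp_assoc)
  then show ?thesis unfolding reflections_def using weyl_comp[OF assms(2) w] by blast
qed

section \<open>Length and the exchange property\<close>

lemma len_le: "len A (word_prod A q) \<le> length q"
  unfolding len_def by (rule Least_le) auto

lemma reduced_word_exists: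
  assumes "w \<in> weyl A"
  obtains q where "word_prod A q = w" "length q = len A w"
proof -
  have "\<exists>n q. length q = n \<and> word_prod A q = w" using assms by (auto simp: weyl_def)
  from LeastI_ex[OF this] show thesis using that unfolding len_def by blast
qed

lemma reduced_wordsD: "q \<in> reduced_words A w \<Longrightarrow> word_prod A q = w"
  "q \<in> reduced_words A w \<Longrightarrow> length q = len A w"
  by (auto simp: reduced_words_def)

text \<open>
  Strong exchange.  Reading the word from the right, the image of \<open>b\<close> changes sign at some letter \<open>j\<close>, and
  just before that it must be \<open>alpha j\<close>.  The reflection in \<open>b\<close> is therefore a conjugate of \<open>s_j\<close>,
  and multiplying by it cancels that letter.
\<close>
lemma exchange:
  assumes "root_vec A b" "nonneg_vec b" "\<not> nonneg_vec (word_prod A q b)"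
  obtains q' where "subseq q' q" "Suc (length q') = length q"
    "word_prod A q' = word_prod A q \<circ> reflect A b"
  using assms(3)
proof (induction q arbitrary: thesis)
  case Nil
  then show ?case using assms by simp
next
  case (Cons j q)
  show ?case
  proof (cases "nonneg_vec (word_prod A q b)")
    case True
    have r: "root_vec A (word_prod A q b)" by (simp add: weyl_root weyl_word assms)
    have eq: "word_prod A q b = alpha j"
      using refl_nonneg[OF r True, of j] Cons.prems(2) by auto
    have "word_prod A q (reflect A b h) = refl j (word_prod A q h)" for h
      using fun_cong[OF weyl_reflect[OF weyl_word], of q b h] by (simp add: eq simple_refl_eq_reflect)
    then show ?thesis by (intro Cons.prems(1)[of q]) (auto simp: fun_eq_iff)
  next
    case False
    from Cons.IH[OF _ this] obtain q' where "subseq q' q" "Suc (length q') = length q"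
      "word_prod A q' = word_prod A q \<circ> reflect A b" by blast
    then show ?thesis by (intro Cons.prems(1)[of "j # q'"]) (auto simp: comp_assoc)
  qed
qed

lemma len_reflect_less:
  assumes "w \<in> weyl A" "root_vec A b" "nonneg_vec b" "\<not> nonneg_vec (w b)"
  shows "len A (w \<circ> reflect A b) < len A w"
proof -
  obtain q where q: "word_prod A q = w" "length q = len A w" using reduced_word_exists assms(1) .
  obtain q' where "Suc (length q') = length q" "word_prod A q' = w \<circ> reflect A b"
    using exchange[OF assms(2,3), of q] assms(4) q by auto
  then show ?thesis using len_le[of q'] q by auto
qed

lemma len_reflect_greater:
  assumes "w \<in> weyl A" "root_vec A b" "nonneg_vec b" "nonneg_vec (w b)" "reflect A b \<in> weyl A"
  shows "len A w < len A (w \<circ> reflect A b)"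
proof -
  have "\<not> nonneg_vec ((w \<circ> reflect A b) b)"
    using assms by (simp add: reflect_self weyl_minus root_sign weyl_root)
  from len_reflect_less[OF weyl_comp[OF assms(1,5)] assms(2,3) this]
  have "len A (w \<circ> reflect A b \<circ> reflect A b) < len A (w \<circ> reflect A b)" .
  moreover have "w \<circ> reflect A b \<circ> reflect A b = w"
    using assms(2) by (simp add: fun_eq_iff reflect_reflect)
  ultimately show ?thesis by (simp only:)
qed

lemma len_reflect_iff:
  assumes "w \<in> weyl A" "root_vec A b" "nonneg_vec b" "reflect A b \<in> weyl A"
  shows "len A w < len A (w \<circ> reflect A b) \<longleftrightarrow> nonneg_vec (w b)"
  using len_reflect_greater len_reflect_less assms by (meson order_less_asym)

lemma len_refl_iff: "w \<in> weyl A \<Longrightarrow> len A w < len A (w \<circ> refl j) \<longleftrightarrow> nonneg_vec (w (alpha j))"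
  using len_reflect_iff[of w "alpha j"] weyl_refl root_alpha by (auto simp: simple_refl_eq_reflect)

lemma len_comp_refl_le:
  assumes "w \<in> weyl A" shows "len A (w \<circ> refl j) \<le> Suc (len A w)"
proof -
  obtain q where "word_prod A q = w" "length q = len A w" using reduced_word_exists assms .
  then show ?thesis using len_le[of "q @ [j]"] by simp
qed

lemma len_refl_up: 
  assumes "w \<in> weyl A" "nonneg_vec (w (alpha j))"
  shows "len A (w \<circ> refl j) = Suc (len A w)"
  using len_comp_refl_le[OF assms(1), of j] len_refl_iff[OF assms(1), of j] assms(2) by simp

lemma len_refl_down: 
  assumes "w \<in> weyl A" "\<not> nonneg_vec (w (alpha j))"
  shows "len A w = Suc (len A (w \<circ> refl j))"
proof -
  have w': "w \<circ> refl j \<in> weyl A" by (simp add: weyl_comp assms weyl_refl)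
  have "nonneg_vec ((w \<circ> refl j) (alpha j))"
    using assms by (simp add: simple_refl_eq_reflect reflect_self root_alpha weyl_minus root_sign weyl_root)
  from len_refl_up[OF w' this] have "len A (w \<circ> refl j \<circ> refl j) = Suc (len A (w \<circ> refl j))" .
  moreover have "w \<circ> refl j \<circ> refl j = w" by (simp add: fun_eq_iff)
  ultimately show ?thesis by (simp only:)
qed

text \<open>
  The deletion property, by adding one letter at a time: either the length goes up, or the exchange property
  removes a letter from the reduced subword found so far.
\<close>
lemma reduced_subword_exists:
  obtains q' where "subseq q' q" "word_prod A q' = word_prod A q" "length q' = len A (word_prod A q)"
proof (induction q arbitrary: thesis rule: rev_induct)
  case Nil
  then show ?case using len_le[of "[]"] by (metis le_zero_eq list.size(3) subseq_order.order_refl)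
next
  case (snoc j q)
  obtain r where r: "subseq r q" "word_prod A r = word_prod A q" "length r = len A (word_prod A q)"
    using snoc.IH by blast
  show ?case
  proof (cases "nonneg_vec (word_prod A q (alpha j))")
    case True
    then show ?thesis using r len_refl_up[OF weyl_word True]
      by (intro snoc.prems[of "r @ [j]"]) (auto simp: o_def)
  next
    case False
    obtain r' where r': "subseq r' r" "Suc (length r') = length r"
      "word_prod A r' = word_prod A r \<circ> reflect A (alpha j)"
      using exchange[OF root_alpha, of r j] False r(2) by auto
    have "subseq r' (q @ [j])" using r r' by (meson subseq_order.trans subseq_rev_drop_many)
    then show ?thesis using r r' len_refl_down[OF weyl_word False]
      by (intro snoc.prems[of r']) (auto simp: simple_refl_eq_reflect o_def)
  qed
qed


section \<open>Bruhat order\<close>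

definition bruhat_step where
  "bruhat_step y z \<longleftrightarrow> y \<in> weyl A \<and> (\<exists>t\<in>reflections A. z = y \<circ> t) \<and> len A y < len A z"

lemma bruhat_le_rtranclp: "bruhat_le A u v \<longleftrightarrow> bruhat_step\<^sup>*\<^sup>* u v"
  unfolding bruhat_le_def bruhat_step_def rtrancl_def by simp

lemma bruhat_refl [simp]: "bruhat_le A u u"
  by (simp add: bruhat_le_rtranclp)

lemma bruhat_trans: "bruhat_le A u v \<Longrightarrow> bruhat_le A v w \<Longrightarrow> bruhat_le A u w"
  unfolding bruhat_le_rtranclp by (rule rtranclp_trans)

lemma bruhat_stepI: "bruhat_step u v \<Longrightarrow> bruhat_le A u v"
  unfolding bruhat_le_rtranclp by blast

lemma bruhat_step_weyl: "bruhat_step u v \<Longrightarrow> v \<in> weyl A"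
  unfolding bruhat_step_def by (metis reflections_cases weyl_comp)

lemma bruhat_le_len: "bruhat_le A u v \<Longrightarrow> u = v \<or> len A u < len A v"
  unfolding bruhat_le_rtranclp by (induction rule: rtranclp_induct) (auto simp: bruhat_step_def)

lemma bruhat_antisym: "bruhat_le A u v \<Longrightarrow> bruhat_le A v u \<Longrightarrow> u = v"
  using bruhat_le_len[of u v] bruhat_le_len[of v u] by auto

lemma bruhat_step_reflect_iff:
  assumes "u \<in> weyl A" "root_vec A b" "nonneg_vec b" "reflect A b \<in> reflections A"
  shows "bruhat_step u (u \<circ> reflect A b) \<longleftrightarrow> nonneg_vec (u b)"
  using len_reflect_iff[OF assms(1-3)] assms reflections_cases[OF assms(4)]
  unfolding bruhat_step_def by metis

lemma bruhat_step_cases: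
  assumes "bruhat_step u v"
  obtains b where "root_vec A b" "nonneg_vec b" "reflect A b \<in> reflections A" "v = u \<circ> reflect A b"
    "nonneg_vec (u b)"
proof -
  obtain t where t: "u \<in> weyl A" "t \<in> reflections A" "v = u \<circ> t"
    using assms unfolding bruhat_step_def by blast
  obtain b where "root_vec A b" "nonneg_vec b" "t = reflect A b" using reflections_cases[OF t(2)] .
  then show thesis using that[of b] t bruhat_step_reflect_iff[of u b] assms by simp
qed

lemma bruhat_refl_up: 
  assumes "w \<in> weyl A" "nonneg_vec (w (alpha j))"
  shows "bruhat_le A w (w \<circ> refl j)"
  using bruhat_step_reflect_iff[OF assms(1) root_alpha, of j] assms(2) reflections_refl[of j]
  by (auto simp: simple_refl_eq_reflect intro: bruhat_stepI)

lemma comp_refl_weyl: "w \<in> weyl A \<Longrightarrow> w \<circ> refl j \<in> weyl A"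
  by (simp add: weyl_comp weyl_refl)

lemma comp_refl_refl: "w \<circ> refl j \<circ> refl j = w"
  by (simp add: fun_eq_iff)

lemma comp_refl_sign: "w \<in> weyl A \<Longrightarrow> nonneg_vec ((w \<circ> refl j) (alpha j)) \<longleftrightarrow> \<not> nonneg_vec (w (alpha j))"
  by (simp add: simple_refl_eq_reflect reflect_self root_alpha weyl_minus root_sign weyl_root)

lemma bruhat_refl_down: 
  assumes "w \<in> weyl A" "\<not> nonneg_vec (w (alpha j))"
  shows "bruhat_le A (w \<circ> refl j) w"
  using bruhat_refl_up[OF comp_refl_weyl[OF assms(1)], of j j] assms comp_refl_sign[OF assms(1), of j]
  by (simp only: comp_refl_refl simp_thms)

text \<open>
  If the reflection is in \<open>b \<noteq> alpha j\<close>, then conjugating it by \<open>s_j\<close> gives the reflection in the positive root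
  \<open>s_j b\<close>, and \<open>(u s_j) (s_j b) = u b\<close> is still positive.  All lifting properties follow from this.
\<close>
lemma bruhat_step_refl:
  assumes "bruhat_step u v"
  shows "v = u \<circ> refl j \<or> bruhat_step (u \<circ> refl j) (v \<circ> refl j)"
proof -
  obtain b where b: "root_vec A b" "nonneg_vec b" "reflect A b \<in> reflections A" "v = u \<circ> reflect A b"
    "nonneg_vec (u b)" using bruhat_step_cases[OF assms] .
  have u: "u \<in> weyl A" using assms by (simp add: bruhat_step_def)
  show ?thesis
  proof (cases "b = alpha j")
    case True then show ?thesis using b by (simp add: simple_refl_eq_reflect)
  next
    case False
    let ?c = "refl j b"
    have c: "root_vec A ?c" "nonneg_vec ?c"
      using b False refl_nonneg root_reflect root_alpha by (auto simp: simple_refl_eq_reflect)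
    have eq: "reflect A ?c = refl j \<circ> reflect A b \<circ> inv (refl j)"
      by (rule conj_reflect[OF weyl_refl, symmetric])
    have "reflect A ?c \<in> reflections A"
      unfolding eq using b(3) weyl_refl by (rule reflections_conj)
    moreover have "nonneg_vec ((u \<circ> refl j) ?c)" using b by simp
    ultimately have "bruhat_step (u \<circ> refl j) (u \<circ> refl j \<circ> reflect A ?c)"
      using bruhat_step_reflect_iff[OF comp_refl_weyl[OF u] c] by blast
    moreover have "reflect A ?c (refl j h) = refl j (reflect A b h)" for h
      using fun_cong[OF weyl_reflect[OF weyl_refl], of j b h] by simp
    then have "u \<circ> refl j \<circ> reflect A ?c = v \<circ> refl j"
      unfolding b(4) fun_eq_iff comp_apply by (metis refl_refl)
    ultimately show ?thesis by simp
  qed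
qed

lemma bruhat_lift_left:
  assumes "bruhat_le A u v"
  shows "bruhat_le A (u \<circ> refl j) v \<or> bruhat_le A (u \<circ> refl j) (v \<circ> refl j)"
  using assms unfolding bruhat_le_rtranclp
proof (induction rule: converse_rtranclp_induct)
  case (step y z)
  then show ?case using bruhat_step_refl[of y z j] by (metis converse_rtranclp_into_rtranclp)
qed auto

lemma bruhat_lift_right:
  assumes "bruhat_le A u v"
  shows "bruhat_le A u (v \<circ> refl j) \<or> bruhat_le A (u \<circ> refl j) (v \<circ> refl j)"
  using assms unfolding bruhat_le_rtranclp
proof (induction rule: rtranclp_induct)
  case (step y z)
  then show ?case using bruhat_step_refl[of y z j] comp_refl_refl[of y j]
    by (metis rtranclp.rtrancl_into_rtrancl)
qed auto

section \<open>Products of subwords\<close>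

definition subword_prods :: "'i list \<Rightarrow> (real ^ 'i \<Rightarrow> real ^ 'i) set" where
  "subword_prods q = word_prod A ` set (subseqs q)"

lemma subword_prods_iff: "u \<in> subword_prods q \<longleftrightarrow> (\<exists>r. subseq r q \<and> u = word_prod A r)"
  by (auto simp: subword_prods_def)

lemma subword_prods_append:
  "subword_prods (p @ q) = {u \<circ> v | u v. u \<in> subword_prods p \<and> v \<in> subword_prods q}"
proof (intro equalityI subsetI)
  fix u assume "u \<in> subword_prods (p @ q)"
  then obtain r where "subseq r (p @ q)" and u: "u = word_prod A r" unfolding subword_prods_iff by blast
  then obtain r1 r2 where "r = r1 @ r2" "subseq r1 p" "subseq r2 q" unfolding subseq_append_iff by blast
  then show "u \<in> {u \<circ> v | u v. u \<in> subword_prods p \<and> v \<in> subword_prods q}"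
    unfolding u subword_prods_iff mem_Collect_eq using word_prod_append by blast
next
  fix u assume "u \<in> {u \<circ> v | u v. u \<in> subword_prods p \<and> v \<in> subword_prods q}"
  then obtain r1 r2 where "u = word_prod A r1 \<circ> word_prod A r2" "subseq r1 p" "subseq r2 q"
    unfolding subword_prods_iff by blast
  then show "u \<in> subword_prods (p @ q)"
    unfolding subword_prods_iff word_prod_append[symmetric] by (metis list_emb_append_mono)
qed

lemma subword_prods_Nil: "subword_prods [] = {id}"
  by (simp add: subword_prods_def)

lemma subword_prods_Cons: "subword_prods (j # q) = (\<circ>) (refl j) ` subword_prods q \<union> subword_prods q"
  unfolding subword_prods_def by (simp add: Let_def image_Un image_image del: in_set_subseqs)

lemma subword_prods_snoc: "subword_prods (q @ [j]) = subword_prods q \<union> (\<lambda>u. u \<circ> refl j) ` subword_prods q"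
proof -
  have "subword_prods [j] = {refl j, id}"
    unfolding subword_prods_Cons subword_prods_Nil by (simp add: insert_commute)
  then have "subword_prods (q @ [j]) = {u \<circ> v | u v. u \<in> subword_prods q \<and> (v = refl j \<or> v = id)}"
    by (simp add: subword_prods_append)
  also have "\<dots> = subword_prods q \<union> (\<lambda>u. u \<circ> refl j) ` subword_prods q"
    by (auto simp: image_iff) (metis comp_id)+
  finally show ?thesis .
qed

text \<open>
  Appending \<open>j\<close> replaces the lower set of \<open>d\<close> by its union with its right translate by \<open>s_j\<close>.  By the two
  lifting properties this is the lower set of the larger one of \<open>d\<close> and \<open>d s_j\<close>.
\<close>
lemma subword_prods_max:
  "\<exists>d\<in>weyl A. subword_prods q = {u. bruhat_le A u d}"
proof (induction q rule: rev_induct)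
  case Nil
  have "u = id" if "bruhat_le A u id" for u
    using bruhat_le_len[OF that] len_le[of "[]"] by simp
  then have "subword_prods [] = {u. bruhat_le A u id}" by (auto simp: subword_prods_Nil)
  then show ?case using weyl_id by blast
next
  case (snoc j q)
  then obtain d where d: "d \<in> weyl A" "subword_prods q = {u. bruhat_le A u d}" by blast
  show ?case
  proof (cases "nonneg_vec (d (alpha j))")
    case True
    note up = bruhat_refl_up[OF d(1) True]
    have "subword_prods (q @ [j]) = {u. bruhat_le A u (d \<circ> refl j)}"
      unfolding subword_prods_snoc d(2)
    proof (intro equalityI subsetI)
      fix u assume "u \<in> {u. bruhat_le A u d} \<union> (\<lambda>u. u \<circ> refl j) ` {u. bruhat_le A u d}"
      then show "u \<in> {u. bruhat_le A u (d \<circ> refl j)}"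
        using bruhat_lift_left[of _ d j] bruhat_trans[OF _ up] by blast
    next
      fix u assume "u \<in> {u. bruhat_le A u (d \<circ> refl j)}"
      then have "bruhat_le A u d \<or> bruhat_le A (u \<circ> refl j) d"
        using bruhat_lift_right[of u "d \<circ> refl j" j] by (simp only: comp_refl_refl mem_Collect_eq)
      moreover have "u = u \<circ> refl j \<circ> refl j" by (simp only: comp_refl_refl)
      ultimately show "u \<in> {u. bruhat_le A u d} \<union> (\<lambda>u. u \<circ> refl j) ` {u. bruhat_le A u d}"
        by blast
    qed
    then show ?thesis using comp_refl_weyl[OF d(1)] by blast
  next
    case False
    note down = bruhat_refl_down[OF d(1) False]
    have "subword_prods (q @ [j]) = {u. bruhat_le A u d}"
      unfolding subword_prods_snoc d(2)
      using bruhat_lift_left[of _ d j] bruhat_trans[OF _ down] by blast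
    then show ?thesis using d(1) by blast
  qed
qed


section \<open>The longest element\<close>

lemma vec_expand: "h = (\<Sum>j\<in>UNIV. h $ j *\<^sub>R alpha j)"
  by (simp add: vec_eq_iff axis_def if_distrib cong: if_cong)

lemma weyl_expand: "w \<in> weyl A \<Longrightarrow> w h = (\<Sum>j\<in>UNIV. h $ j *\<^sub>R w (alpha j))"
  by (subst vec_expand[of h]) (simp add: weyl_linear linear_sum linear_scale)

text \<open>
  Compactness of the unit sphere turns positive definiteness into a uniform bound, which makes the set of roots,
  and with it the Weyl group, finite.
\<close>
lemma form_bounded_below:
  obtains c where "c > 0" "\<And>v. c * (norm v)\<^sup>2 \<le> v \<bullet>\<^sub>A v"
proof -
  let ?S = "sphere (0 :: real ^ 'i) 1"
  have "axis undefined 1 \<in> ?S" by (simp add: norm_axis_1)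
  then have "?S \<noteq> {}" by blast
  moreover have "continuous_on ?S (\<lambda>v. v \<bullet>\<^sub>A v)"
    unfolding cartan_form_def by (intro continuous_intros)
  ultimately obtain m where m: "m \<in> ?S" "\<forall>v\<in>?S. m \<bullet>\<^sub>A m \<le> v \<bullet>\<^sub>A v"
    using continuous_attains_inf[OF compact_sphere] by blast
  have "m \<bullet>\<^sub>A m * (norm v)\<^sup>2 \<le> v \<bullet>\<^sub>A v" for v
  proof (cases "v = 0")
    case False
    let ?u = "(1 / norm v) *\<^sub>R v"
    have "?u \<in> ?S" using False by simp
    then have "m \<bullet>\<^sub>A m \<le> ?u \<bullet>\<^sub>A ?u" using m(2) by blast
    then show ?thesis using False by (simp add: cartan_form_bilinear field_simps power2_eq_square)
  qed (simp add: cartan_form_def)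
  moreover have "m \<bullet>\<^sub>A m > 0" using m(1) by (intro form_pos) auto
  ultimately show thesis using that by blast
qed

lemma finite_roots: "finite {v. root_vec A v}"
proof -
  obtain c where c: "c > 0" "\<And>v. c * (norm v)\<^sup>2 \<le> v \<bullet>\<^sub>A v"
    using form_bounded_below by blast
  define S where "S = {x :: real. x \<in> \<int> \<and> \<bar>x\<bar> \<le> sqrt (2 / c)}"
  have "finite S" unfolding S_def by (rule finite_abs_int_segment)
  then have "finite (vec_lambda ` (PiE (UNIV :: 'i set) (\<lambda>_. S)))"
    by (intro finite_imageI finite_PiE) auto
  moreover have "{v. root_vec A v} \<subseteq> vec_lambda ` (PiE (UNIV :: 'i set) (\<lambda>_. S))"
  proof
    fix v assume "v \<in> {v. root_vec A v}"
    then have v: "integral_vec v" "v \<bullet>\<^sub>A v = 2" by (auto simp: root_vec_def)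
    have "(norm v)\<^sup>2 \<le> 2 / c" using c(2)[of v] c(1) v(2) by (simp add: field_simps)
    then have "norm v \<le> sqrt (2 / c)" by (rule real_le_rsqrt)
    then have "\<bar>v $ i\<bar> \<le> sqrt (2 / c)" for i
      using component_le_norm_cart[of v i] by linarith
    then have "vec_nth v \<in> PiE (UNIV :: 'i set) (\<lambda>_. S)"
      using v(1) by (auto simp: S_def integral_vec_def)
    then show "v \<in> vec_lambda ` (PiE (UNIV :: 'i set) (\<lambda>_. S))"
      by (metis image_eqI vec_nth_inverse)
  qed
  ultimately show ?thesis by (rule finite_subset[rotated])
qed

lemma finite_weyl: "finite (weyl A)"
proof (rule inj_on_finite)
  show "inj_on (\<lambda>w j. w (alpha j)) (weyl A)"
  proof (rule inj_onI)
    fix u v assume uv: "u \<in> weyl A" "v \<in> weyl A" and eq: "(\<lambda>j. u (alpha j)) = (\<lambda>j. v (alpha j))"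
    have "u h = v h" for h
      unfolding weyl_expand[OF uv(1), of h] weyl_expand[OF uv(2), of h] by (simp add: fun_cong[OF eq])
    then show "u = v" by (rule ext)
  qed
  show "(\<lambda>w j. w (alpha j)) ` weyl A \<subseteq> PiE UNIV (\<lambda>_. {v. root_vec A v})"
    by (auto simp: weyl_root root_alpha)
  show "finite (PiE (UNIV :: 'i set) (\<lambda>_. {v. root_vec A v}))"
    by (intro finite_PiE) (auto simp: finite_roots)
qed

abbreviation w0 where "w0 \<equiv> longest A"

lemma longest_weyl: "w0 \<in> weyl A" and longest_max: "w \<in> weyl A \<Longrightarrow> len A w \<le> len A w0"
proof -
  have "finite (len A ` weyl A)" using finite_weyl by simp
  then obtain b where "\<forall>w. w \<in> weyl A \<longrightarrow> len A w < b"
    unfolding finite_nat_set_iff_bounded by auto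
  from arg_max_nat_lemma[of "\<lambda>w. w \<in> weyl A", OF weyl_id this]
  show "w0 \<in> weyl A" "w \<in> weyl A \<Longrightarrow> len A w \<le> len A w0"
    unfolding longest_def arg_max_on_def by auto
qed

lemma longest_alpha: "\<not> nonneg_vec (w0 (alpha j))"
  using longest_max[OF comp_refl_weyl[OF longest_weyl], of j] len_refl_up[OF longest_weyl, of j] by auto

lemma weyl_nonneg_comb:
  assumes "w \<in> weyl A" "nonneg_vec h" "\<And>j. h $ j = 0 \<or> nonneg_vec (w (alpha j))"
  shows "nonneg_vec (w h)"
  unfolding nonneg_vec_def
proof
  fix i
  have "0 \<le> h $ j * w (alpha j) $ i" for j
    using assms(2) assms(3)[of j] by (auto simp: nonneg_vec_def)
  then show "0 \<le> w h $ i" using weyl_expand[OF assms(1), of h] by (simp add: sum_nonneg)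
qed

lemma weyl_neg_comb:
  assumes "w \<in> weyl A" "nonneg_vec h" "\<And>j. \<not> nonneg_vec (w (alpha j))"
  shows "nonneg_vec (- w h)"
  unfolding nonneg_vec_def
proof
  fix i
  have "nonneg_vec (- w (alpha j))" for j
    using assms(3) root_sign[OF weyl_root[OF assms(1) root_alpha(1)]] by blast
  then have "h $ j * w (alpha j) $ i \<le> 0" for j
    using assms(2) by (auto simp: nonneg_vec_def mult_nonneg_nonpos)
  then show "0 \<le> (- w h) $ i" using weyl_expand[OF assms(1), of h] by (simp add: sum_nonpos)
qed

text \<open>
  If \<open>w\<close> had a reduced word with last letter \<open>j\<close>, then \<open>w (alpha j)\<close> would be negative.
\<close>
lemma weyl_eq_id:
  assumes "w \<in> weyl A" "\<And>j. nonneg_vec (w (alpha j))"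
  shows "w = id"
proof -
  obtain q where q: "word_prod A q = w" "length q = len A w" using reduced_word_exists assms(1) .
  show ?thesis
  proof (cases q rule: rev_cases)
    case Nil then show ?thesis using q by simp
  next
    case (snoc r j)
    have "w \<circ> refl j = word_prod A r" unfolding q(1)[symmetric] snoc by (simp add: fun_eq_iff)
    then have "len A (w \<circ> refl j) \<le> length r" using len_le by simp
    then show ?thesis using len_refl_up[OF assms(1) assms(2), of j] q(2) snoc by simp
  qed
qed

text \<open>
  Both \<open>w\<close> and \<open>w0\<close> send every positive root to a negative one, so their product preserves positivity.  For
  \<open>w = w0\<close> this shows that \<open>w0\<close> is an involution.
\<close>
lemma all_negative_comp_longest:
  assumes "w \<in> weyl A" "\<And>j. \<not> nonneg_vec (w (alpha j))"
  shows "w \<circ> w0 = id"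
proof (rule weyl_eq_id)
  show "w \<circ> w0 \<in> weyl A" using assms(1) longest_weyl by (rule weyl_comp)
  fix j
  have "nonneg_vec (- w0 (alpha j))"
    using longest_alpha root_sign[OF weyl_root[OF longest_weyl root_alpha(1)]] by blast
  then have "nonneg_vec (- w (- w0 (alpha j)))" using weyl_neg_comb assms by blast
  then show "nonneg_vec ((w \<circ> w0) (alpha j))" using assms(1) by (simp add: weyl_minus)
qed

lemma longest_longest: "w0 (w0 h) = h"
  using fun_cong[OF all_negative_comp_longest[OF longest_weyl longest_alpha], of h] by simp

lemma comp_longest_longest: "w \<circ> w0 \<circ> w0 = w"
  by (simp add: fun_eq_iff longest_longest)

text \<open>
  Since \<open>s_j w0 \<noteq> w0\<close>, some simple root \<open>alpha i\<close> becomes positive under \<open>s_j w0\<close>.  Then \<open>s_j\<close> changes the sign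
  of the root \<open>w0 (alpha i)\<close>, which only happens for \<open>- alpha j\<close>.
\<close>
lemma longest_permutes_simple:
  obtains i where "w0 (alpha i) = - alpha j" "w0 (alpha j) = - alpha i"
proof -
  have rw: "refl j \<circ> w0 \<in> weyl A" using weyl_refl longest_weyl by (rule weyl_comp)
  have "\<exists>i. nonneg_vec ((refl j \<circ> w0) (alpha i))"
  proof (rule ccontr)
    assume "\<not> ?thesis"
    then have "refl j \<circ> w0 \<circ> w0 = id" using all_negative_comp_longest[OF rw] by blast
    then have "refl j (alpha j) = alpha j" by (simp only: comp_longest_longest id_apply)
    then have "- alpha j = alpha j" by (simp add: simple_refl_eq_reflect reflect_self root_alpha)
    then have "(- alpha j) $ j = alpha j $ j" by (rule arg_cong)
    then show False by (simp add: axis_def)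
  qed
  then obtain i where i: "nonneg_vec (refl j (w0 (alpha i)))" by auto
  let ?v = "- w0 (alpha i)"
  have v: "root_vec A ?v" "nonneg_vec ?v"
    using longest_alpha root_sign[OF weyl_root[OF longest_weyl root_alpha(1)]]
      root_minus weyl_root[OF longest_weyl root_alpha(1)] by blast+
  have "refl j ?v = - refl j (w0 (alpha i))" by (rule weyl_minus[OF weyl_refl])
  moreover have "root_vec A (refl j ?v)" using v weyl_root[OF weyl_refl] by blast
  ultimately have "\<not> nonneg_vec (refl j ?v)"
    using i root_sign[of "refl j ?v"] by simp
  then have "?v = alpha j" using refl_nonneg v by blast
  then have "w0 (alpha i) = - alpha j" by (metis minus_minus)
  moreover from this have "w0 (- alpha j) = alpha i" using longest_longest by metis
  then have "w0 (alpha j) = - alpha i" by (simp add: weyl_minus longest_weyl minus_equation_iff)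
  ultimately show thesis by (rule that)
qed

text \<open>
  The reflection in \<open>b\<close> is turned by \<open>w0\<close> into the one in the positive root \<open>- w0 b\<close>, and
  \<open>v w0\<close> sends that root to \<open>u b\<close>, which is positive.
\<close>
lemma bruhat_step_reverse:
  assumes "bruhat_step u v"
  shows "bruhat_step (v \<circ> w0) (u \<circ> w0)"
proof -
  obtain b where b: "root_vec A b" "nonneg_vec b" "reflect A b \<in> reflections A" "v = u \<circ> reflect A b"
    "nonneg_vec (u b)" using bruhat_step_cases[OF assms] .
  have u: "u \<in> weyl A" using assms by (simp add: bruhat_step_def)
  have v: "v \<in> weyl A" using bruhat_step_weyl[OF assms] .
  let ?c = "- w0 b"
  have c: "root_vec A ?c" "nonneg_vec ?c"
    using b weyl_neg_comb[OF longest_weyl _ longest_alpha] root_minus weyl_root[OF longest_weyl] by blast+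
  have "reflect A ?c = w0 \<circ> reflect A b \<circ> inv w0"
    by (simp only: reflect_minus conj_reflect[OF longest_weyl])
  then have r: "reflect A ?c \<in> reflections A" using reflections_conj[OF b(3) longest_weyl] by simp
  have "(v \<circ> w0) ?c = u b"
    using b(1) u by (simp add: weyl_minus longest_weyl longest_longest b(4) reflect_self
        weyl_linear linear_neg linear_reflect)
  then have "bruhat_step (v \<circ> w0) (v \<circ> w0 \<circ> reflect A ?c)"
    using bruhat_step_reflect_iff[OF weyl_comp[OF v longest_weyl] c r] b(5) by simp
  moreover have "w0 (reflect A ?c h) = reflect A b (w0 h)" for h
    using fun_cong[OF weyl_reflect[OF longest_weyl], of "w0 b" h] by (simp add: reflect_minus longest_longest)
  then have "v \<circ> w0 \<circ> reflect A ?c = u \<circ> w0"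
    using b(1) by (simp add: fun_eq_iff b(4) reflect_reflect)
  ultimately show ?thesis by simp
qed

lemma bruhat_reverse: 
  assumes "bruhat_le A u v" shows "bruhat_le A (v \<circ> w0) (u \<circ> w0)"
  using assms unfolding bruhat_le_rtranclp
proof (induction rule: rtranclp_induct)
  case (step y z)
  then show ?case using bruhat_step_reverse[of y z] by (metis converse_rtranclp_into_rtranclp)
qed auto

lemma bruhat_reverse_iff: "bruhat_le A (u \<circ> w0) v \<longleftrightarrow> bruhat_le A (v \<circ> w0) u"
  using bruhat_reverse[of "u \<circ> w0" v] bruhat_reverse[of "v \<circ> w0" u] by (auto simp only: comp_longest_longest)

section \<open>Braid moves\<close>

definition braid_step :: "'i list \<Rightarrow> 'i list \<Rightarrow> bool" where
  "braid_step ii jj \<longleftrightarrow> (\<exists>k. two_move A k ii jj \<or> three_move A k ii jj)"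

lemma braid_step_append: "braid_step ii jj \<Longrightarrow> braid_step (ii @ r) (jj @ r)"
  unfolding braid_step_def two_move_def three_move_def by (metis append.assoc)

lemma braid_append: "braid_step\<^sup>*\<^sup>* ii jj \<Longrightarrow> braid_step\<^sup>*\<^sup>* (ii @ r) (jj @ r)"
  by (induction rule: rtranclp_induct) (auto intro: braid_step_append rtranclp.rtrancl_into_rtrancl)

lemma refl_commute: "A i j = 0 \<Longrightarrow> refl i (refl j h) = refl j (refl i h)"
  using sym[of i j]
  by (simp add: simple_refl_eq_reflect reflect_def cartan_form_bilinear cartan_form_axis)

lemma refl_braid: "A i j = -1 \<Longrightarrow> refl i (refl j (refl i h)) = refl j (refl i (refl j h))"
  using sym[of i j]
  by (simp add: simple_refl_eq_reflect reflect_def cartan_form_bilinear cartan_form_axis diag algebra_simps)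

lemma braid_step_prod: 
  assumes "braid_step ii jj" shows "word_prod A ii = word_prod A jj" "length ii = length jj"
proof -
  have comm: "refl i \<circ> refl j = refl j \<circ> refl i" if "A i j = 0" for i j
    by (rule ext) (simp add: refl_commute[OF that])
  have braid: "refl i \<circ> (refl j \<circ> refl i) = refl j \<circ> (refl i \<circ> refl j)" if "A i j = -1" for i j
    by (rule ext) (simp add: refl_braid[OF that])
  have two: "word_prod A [i, j] = word_prod A [j, i]" if "A i j = 0" for i j
    using comm[OF that] by simp
  have three: "word_prod A [i, j, i] = word_prod A [j, i, j]" if "A i j = -1" for i j
    using braid[OF that] by simp
  show "word_prod A ii = word_prod A jj"
  proof -
    have "word_prod A (p @ x @ q) = word_prod A (p @ y @ q)"
      if "word_prod A x = word_prod A y" for p x y q using that by (simp only: word_prod_append)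
    then show ?thesis
      using assms two three unfolding braid_step_def two_move_def three_move_def by metis
  qed
  show "length ii = length jj"
    using assms unfolding braid_step_def two_move_def three_move_def by auto
qed

lemma braid_step_reduced: "braid_step ii jj \<Longrightarrow> ii \<in> reduced_words A w \<Longrightarrow> jj \<in> reduced_words A w"
  using braid_step_prod[of ii jj] by (simp add: reduced_words_def)

lemma reduced_snoc:
  assumes "p @ [j] \<in> reduced_words A w"
  shows "p \<in> reduced_words A (w \<circ> refl j)" "\<not> nonneg_vec (w (alpha j))" "w \<in> weyl A"
proof -
  have w: "word_prod A (p @ [j]) = w" "Suc (length p) = len A w"
    using assms by (auto simp: reduced_words_def)
  have p: "w \<circ> refl j = word_prod A p" unfolding w(1)[symmetric] by (simp add: fun_eq_iff)
  show W: "w \<in> weyl A" using w(1) weyl_word by blast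
  have le: "len A (w \<circ> refl j) \<le> length p" using len_le[of p] p by simp
  then show neg: "\<not> nonneg_vec (w (alpha j))" using len_refl_up[OF W, of j] w(2) by auto
  show "p \<in> reduced_words A (w \<circ> refl j)"
    using len_refl_down[OF W neg] w(2) p by (simp add: reduced_words_def)
qed

lemma reduced_snocI:
  assumes "w \<in> weyl A" "\<not> nonneg_vec (w (alpha j))" "p \<in> reduced_words A (w \<circ> refl j)"
  shows "p @ [j] \<in> reduced_words A w"
  using assms(3) len_refl_down[OF assms(1,2)]
  by (auto simp: reduced_words_def fun_eq_iff)

lemma reduced_words_nonempty: "w \<in> weyl A \<Longrightarrow> \<exists>q. q \<in> reduced_words A w"
  using reduced_word_exists[of w] unfolding reduced_words_def by (metis (mono_tags) mem_Collect_eq)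

text \<open>
  Induction on the length.  If the last letters \<open>s \<noteq> t\<close> differ, both are right descents of \<open>w\<close>; then
  \<open>w\<close> has reduced words ending in the two braid-equivalent words in \<open>s, t\<close>, which are compared with the given
  words by the induction hypothesis.
\<close>
lemma matsumoto:
  assumes "ii \<in> reduced_words A w" "jj \<in> reduced_words A w"
  shows "braid_step\<^sup>*\<^sup>* ii jj"
  using assms
proof (induction "length ii" arbitrary: ii jj w)
  case 0
  then have "ii = []" "jj = []"
    using reduced_wordsD(2)[OF "0.prems"(1)] reduced_wordsD(2)[OF "0.prems"(2)] by auto
  then show ?case by simp
next
  case (Suc n)
  have "length jj = Suc n" using Suc by (simp add: reduced_words_def)
  then obtain p s q t where ii: "ii = p @ [s]" and jj: "jj = q @ [t]"
    using Suc.hyps(2) by (metis length_Suc_conv_rev)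
  note p = reduced_snoc[OF Suc.prems(1)[unfolded ii]] and q = reduced_snoc[OF Suc.prems(2)[unfolded jj]]
  have len_p: "n = length p" and len_q: "n = length q"
    using ii jj Suc.hyps(2) \<open>length jj = Suc n\<close> by auto
  note IH_p = Suc.hyps(1)[OF len_p p(1)] and IH_q = Suc.hyps(1)[OF len_q q(1)]
  have wst: "root_vec A (w (alpha s))" "root_vec A (w (alpha t))" using p(3) by (auto simp: weyl_root root_alpha)
  note ws = comp_refl_weyl[OF p(3), of s] and wt = comp_refl_weyl[OF p(3), of t]
  show ?case
  proof (cases "s = t")
    case True
    then show ?thesis using IH_p[of q] q(1) braid_append unfolding ii jj by blast
  next
    case False
    then consider "A s t = 0" | "A s t = -1" using off_diag by blast
    then show ?thesis
    proof cases
      case 1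
      have comm: "w \<circ> refl s \<circ> refl t = w \<circ> refl t \<circ> refl s"
        by (simp add: fun_eq_iff refl_commute[OF 1])
      have "refl s (alpha t) = alpha t" "refl t (alpha s) = alpha s"
        using 1 sym[of s t]
        by (simp_all add: simple_refl_eq_reflect reflect_def cartan_form_axis)
      then have neg: "\<not> nonneg_vec ((w \<circ> refl s) (alpha t))" "\<not> nonneg_vec ((w \<circ> refl t) (alpha s))"
        using p(2) q(2) by auto
      obtain r where r: "r \<in> reduced_words A (w \<circ> refl s \<circ> refl t)"
        using reduced_words_nonempty[OF comp_refl_weyl[OF ws]] by blast
      have "braid_step\<^sup>*\<^sup>* p (r @ [t])" using IH_p[OF reduced_snocI[OF ws neg(1) r]] .
      then have "braid_step\<^sup>*\<^sup>* ii (r @ [t, s])" unfolding ii using braid_append[of p "r @ [t]" "[s]"] by simp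
      moreover have "two_move A (length r) (r @ [t, s]) (r @ [s, t])"
        unfolding two_move_def using 1 sym[of s t]
        by (intro exI[of _ r] exI[of _ "[]"] exI[of _ t] exI[of _ s]) simp
      then have "braid_step (r @ [t, s]) (r @ [s, t])" unfolding braid_step_def by blast
      moreover have "r @ [s] \<in> reduced_words A (w \<circ> refl t)"
        using r unfolding comm by (intro reduced_snocI wt neg)
      then have "braid_step\<^sup>*\<^sup>* (r @ [s]) q"
        using Suc.hyps(1)[of "r @ [s]"] q(1) len_q by (simp add: reduced_words_def)
      then have "braid_step\<^sup>*\<^sup>* (r @ [s, t]) jj" unfolding jj using braid_append[of "r @ [s]" q "[t]"] by simp
      ultimately show ?thesis by (meson rtranclp.rtrancl_into_rtrancl rtranclp_trans)
    next
      case 2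
      have comm: "w \<circ> refl s \<circ> refl t \<circ> refl s = w \<circ> refl t \<circ> refl s \<circ> refl t"
        by (simp add: fun_eq_iff refl_braid[OF 2])
      have sum: "refl s (alpha t) = alpha s + alpha t" "refl t (alpha s) = alpha s + alpha t"
        using 2 sym[of s t]
        by (simp_all add: simple_refl_eq_reflect reflect_def cartan_form_axis)
      \<comment> \<open>As w sends alpha s + alpha t to a negative root too, each of the three letters of
        the braid word lowers the length.\<close>
      have "nonneg_vec (- w (alpha s))" "nonneg_vec (- w (alpha t))"
        using root_sign wst p(2) q(2) by blast+
      then have "nonneg_vec (- w (alpha s + alpha t))"
        using nonneg_vec_add[of "- w (alpha s)" "- w (alpha t)"] p(3)
        by (simp add: weyl_linear linear_add)
      moreover have "root_vec A (w (alpha s + alpha t))"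
        using weyl_root[OF p(3) weyl_root[OF weyl_refl root_alpha(1)], of s t] unfolding sum(1) .
      ultimately have nsum: "\<not> nonneg_vec (w (alpha s + alpha t))" using root_sign by blast
      then have neg: "\<not> nonneg_vec ((w \<circ> refl s) (alpha t))" "\<not> nonneg_vec ((w \<circ> refl t) (alpha s))"
        using sum by auto
      have "refl s (alpha s + alpha t) = alpha t" "refl t (alpha s + alpha t) = alpha s"
        using sum refl_refl by metis+
      then have neg2: "\<not> nonneg_vec ((w \<circ> refl s \<circ> refl t) (alpha s))"
          "\<not> nonneg_vec ((w \<circ> refl t \<circ> refl s) (alpha t))"
        using sum p(2) q(2) by auto
      obtain r where r: "r \<in> reduced_words A (w \<circ> refl s \<circ> refl t \<circ> refl s)"
        using reduced_words_nonempty[OF comp_refl_weyl[OF comp_refl_weyl[OF ws]]] by blast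
      have "(r @ [s]) @ [t] \<in> reduced_words A (w \<circ> refl s)"
        by (intro reduced_snocI ws neg neg2 comp_refl_weyl r)
      then have "braid_step\<^sup>*\<^sup>* p (r @ [s, t])" using IH_p by simp
      then have "braid_step\<^sup>*\<^sup>* ii (r @ [s, t, s])" unfolding ii using braid_append[of p "r @ [s, t]" "[s]"] by simp
      moreover have "three_move A (length r) (r @ [s, t, s]) (r @ [t, s, t])"
        unfolding three_move_def using 2 sym[of s t]
        by (intro exI[of _ r] exI[of _ "[]"] exI[of _ s] exI[of _ t]) simp
      then have "braid_step (r @ [s, t, s]) (r @ [t, s, t])" unfolding braid_step_def by blast
      moreover have "(r @ [t]) @ [s] \<in> reduced_words A (w \<circ> refl t)"
        using r unfolding comm by (intro reduced_snocI wt neg neg2 comp_refl_weyl)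
      then have "braid_step\<^sup>*\<^sup>* (r @ [t, s]) q"
        using Suc.hyps(1)[of "r @ [t, s]"] q(1) len_q by (simp add: reduced_words_def)
      then have "braid_step\<^sup>*\<^sup>* (r @ [t, s, t]) jj" unfolding jj using braid_append[of "r @ [t, s]" q "[t]"] by simp
      ultimately show ?thesis by (meson rtranclp.rtrancl_into_rtrancl rtranclp_trans)
    qed
  qed
qed


section \<open>Subwords at vanishing edges\<close>

definition zero_letters :: "(nat \<Rightarrow> nat) \<Rightarrow> 'i list \<Rightarrow> 'i list" where
  "zero_letters n ii = nths ii {k. n (Suc k) = 0}"

lemma zero_letters_append:
  "zero_letters n (p @ q) = zero_letters n p @ zero_letters (\<lambda>l. n (l + length p)) q"
  by (simp add: zero_letters_def nths_append)

lemma zero_letters_Cons: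
  "zero_letters n (j # q) = (if n 1 = 0 then [j] else []) @ zero_letters (\<lambda>l. n (Suc l)) q"
  by (simp add: zero_letters_def nths_Cons)

lemma zero_letters_Nil: "zero_letters n [] = []"
  by (simp add: zero_letters_def)

lemma zero_letters_cong:
  "(\<And>l. l \<in> {1..length q} \<Longrightarrow> n l = n' l) \<Longrightarrow> zero_letters n q = zero_letters n' q"
proof (induction q arbitrary: n n')
  case (Cons j q)
  have "zero_letters (\<lambda>l. n (Suc l)) q = zero_letters (\<lambda>l. n' (Suc l)) q"
    by (rule Cons.IH) (simp add: Cons.prems)
  moreover have "n 1 = n' 1" by (rule Cons.prems) simp
  ultimately show ?case by (simp only: zero_letters_Cons)
qed (simp add: zero_letters_Nil)

text \<open>
  Increasing position sequences, counted from 1, correspond to sets of list indices, counted from 0; this makes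
  the list library available for subwords.
\<close>
lemma subword_eq_nths:
  fixes ii :: "'i list"
  assumes "as \<in> position_seqs ii"
  shows "subword ii as = nths ii {k. Suc k \<in> set as}"
proof -
  have nths: "nths xs S = map ((!) xs) (filter (\<lambda>k. k \<in> S) [0..<length xs])" for xs :: "'i list" and S
  proof (induction xs rule: rev_induct)
    case (snoc x xs)
    then show ?case by (auto simp: nths_append nth_append intro!: map_cong)
  qed simp
  have as: "sorted_wrt (<) as" "set as \<subseteq> {1..length ii}"
    using assms by (auto simp: position_seqs_def)
  have "as = filter (\<lambda>a. a \<in> set as) (map Suc [0..<length ii])"
  proof (rule strict_sorted_equal)
    show "sorted_wrt (<) (filter (\<lambda>a. a \<in> set as) (map Suc [0..<length ii]))"
      by (intro sorted_wrt_filter) (simp add: map_Suc_upt del: upt_Suc)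
    show "set as = set (filter (\<lambda>a. a \<in> set as) (map Suc [0..<length ii]))"
      unfolding map_Suc_upt using as(2) by auto
  qed (rule as(1))
  then have "subword ii as = map (\<lambda>a. ii ! (a - 1)) (filter (\<lambda>a. a \<in> set as) (map Suc [0..<length ii]))"
    unfolding subword_def by simp
  then show ?thesis by (simp add: nths filter_map o_def)
qed

lemma nths_mono: "S \<subseteq> T \<Longrightarrow> subseq (nths xs S) (nths xs T)"
proof (induction xs arbitrary: S T)
  case (Cons x xs)
  have "subseq (nths xs {j. Suc j \<in> S}) (nths xs {j. Suc j \<in> T})"
    using Cons.prems by (intro Cons.IH) auto
  then show ?case using Cons.prems by (auto simp: nths_Cons)
qed simp

lemma subwords_at_zeros:
  "{subword ii as | as. as \<in> position_seqs ii \<and> (\<forall>a\<in>set as. n a = 0)} = {r. subseq r (zero_letters n ii)}"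
proof (intro equalityI subsetI)
  fix r assume "r \<in> {subword ii as | as. as \<in> position_seqs ii \<and> (\<forall>a\<in>set as. n a = 0)}"
  then obtain as where as: "as \<in> position_seqs ii" "\<forall>a\<in>set as. n a = 0" "r = subword ii as" by blast
  then show "r \<in> {r. subseq r (zero_letters n ii)}"
    unfolding zero_letters_def by (auto simp: subword_eq_nths intro: nths_mono)
next
  fix r assume "r \<in> {r. subseq r (zero_letters n ii)}"
  then obtain S where r: "r = nths ii S" and S: "S \<subseteq> {k. n (Suc k) = 0}"
    unfolding zero_letters_def by (auto simp: subseq_conv_nths nths_nths)
  define as where "as = filter (\<lambda>a. a - 1 \<in> S) [1..<Suc (length ii)]"
  have as: "as \<in> position_seqs ii"
    unfolding position_seqs_def as_def by (auto intro!: sorted_wrt_filter simp del: upt_Suc)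
  have "nths ii {k. Suc k \<in> set as} = nths ii S"
    unfolding nths_def
    by (intro arg_cong[where f = "map fst"] filter_cong refl) (auto simp: as_def set_zip)
  then have "r = subword ii as" using as r by (simp add: subword_eq_nths)
  moreover have "\<forall>a\<in>set as. n a = 0" using S by (auto simp: as_def simp del: upt_Suc)
  ultimately show "r \<in> {subword ii as | as. as \<in> position_seqs ii \<and> (\<forall>a\<in>set as. n a = 0)}"
    using as by blast
qed

lemma subword_prods_append_cong:
  assumes "subword_prods x = subword_prods y"
  shows "subword_prods (p @ x @ q) = subword_prods (p @ y @ q)"
  by (simp only: subword_prods_append assms)

lemma subword_prods_double: "subword_prods [i, i] = subword_prods [i]"
  by (simp add: subword_prods_Cons subword_prods_Nil insert_commute)

lemma subword_prods_commute: 
  assumes "A i j = 0" shows "subword_prods [i, j] = subword_prods [j, i]"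
proof -
  have "refl i \<circ> refl j = refl j \<circ> refl i" by (rule ext) (simp add: refl_commute[OF assms])
  then show ?thesis by (simp add: subword_prods_Cons subword_prods_Nil insert_commute)
qed

lemma subword_prods_braid: 
  assumes "A i j = -1" shows "subword_prods [i, j, i] = subword_prods [j, i, j]"
proof -
  have "refl i \<circ> (refl j \<circ> refl i) = refl j \<circ> (refl i \<circ> refl j)"
    by (rule ext) (simp add: refl_braid[OF assms])
  then show ?thesis by (simp add: subword_prods_Cons subword_prods_Nil) blast
qed

section \<open>MV data\<close>

text \<open>
  The letters outside the move keep their edge lengths.  For a 3-move with lengths \<open>a, b, c\<close> the new lengths vanish,
  respectively, when \<open>b = 0\<close> and \<open>c \<le> a\<close>; when \<open>a = 0\<close> or \<open>c = 0\<close>; and when \<open>b = 0\<close> and \<open>a \<le> c\<close>.  In each case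
  the two surviving words are equal, or are \<open>[j]\<close> and \<open>[j, j]\<close>, or \<open>[i, i]\<close> and \<open>[i]\<close>, or the
  two full braid words, and these have the same subword products.
\<close>
lemma braid_step_zero_prods:
  assumes mv: "mv_datum A \<mu>" and ii: "ii \<in> reduced_words A w0" and step: "braid_step ii jj"
  shows "subword_prods (zero_letters (edge_length A \<mu> ii) ii)
       = subword_prods (zero_letters (edge_length A \<mu> jj) jj)"
proof -
  define n n' where "n = edge_length A \<mu> ii" and "n' = edge_length A \<mu> jj"
  have jj: "jj \<in> reduced_words A w0" using braid_step_reduced step ii .
  obtain k where k: "two_move A k ii jj \<or> three_move A k ii jj" using step braid_step_def by blast
  have rel: "(two_move A k ii jj \<longrightarrow>
           (\<forall>l\<in>{1..length ii} - {k+1, k+2}. n l = n' l) \<and>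
           n (k+1) = n' (k+2) \<and> n (k+2) = n' (k+1)) \<and>
        (three_move A k ii jj \<longrightarrow>
           (\<forall>l\<in>{1..length ii} - {k+1, k+2, k+3}. n l = n' l) \<and>
           n' (k+1) = n (k+2) + n (k+3) - min (n (k+1)) (n (k+3)) \<and>
           n' (k+2) = min (n (k+1)) (n (k+3)) \<and>
           n' (k+3) = n (k+1) + n (k+2) - min (n (k+1)) (n (k+3)))"
    using mv ii jj unfolding mv_datum_def Let_def n_def n'_def by blast
  \<comment> \<open>The part of the argument that is common to both kinds of moves: only the letters of the
    move itself have to be compared.\<close>
  have glue: "subword_prods (zero_letters n (p @ x @ q)) = subword_prods (zero_letters n' (p @ y @ q))"
    if p: "length p = k" and xy: "length y = length x"
      and agree: "\<And>l. l \<in> {1..length (p @ x @ q)} \<Longrightarrow> l \<notin> {k+1..k+length x} \<Longrightarrow> n l = n' l"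
      and middle: "subword_prods (zero_letters (\<lambda>l. n (l + k)) x) = subword_prods (zero_letters (\<lambda>l. n' (l + k)) y)"
    for p q x y
  proof -
    have split: "zero_letters m (p @ z @ q) = zero_letters m p
        @ zero_letters (\<lambda>l. m (l + k)) z @ zero_letters (\<lambda>l. m (l + length z + k)) q" for m z
      unfolding zero_letters_append p ..
    have "zero_letters n p = zero_letters n' p"
      using p by (intro zero_letters_cong agree) auto
    moreover have "zero_letters (\<lambda>l. n (l + length x + k)) q = zero_letters (\<lambda>l. n' (l + length x + k)) q"
      using p by (intro zero_letters_cong agree) auto
    ultimately show ?thesis
      unfolding split xy by (simp only: subword_prods_append_cong[OF middle])
  qed
  show ?thesis unfolding n_def[symmetric] n'_def[symmetric] using k
  proof
    assume two: "two_move A k ii jj"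
    then obtain p q i j where p: "length p = k" and ij: "A i j = 0"
      and eq: "ii = p @ [i, j] @ q" "jj = p @ [j, i] @ q" unfolding two_move_def by blast
    have n': "n' (k+1) = n (k+2)" "n' (k+2) = n (k+1)" using rel two by simp_all
    have z: "zero_letters (\<lambda>l. m (l + k)) [x, y] = (if m (k+1) = 0 then [x] else []) @
        (if m (k+2) = 0 then [y] else [])" for m x y
      by (simp add: zero_letters_Cons zero_letters_Nil eval_nat_numeral)
    show "subword_prods (zero_letters n ii) = subword_prods (zero_letters n' jj)"
      unfolding eq
    proof (rule glue[OF p])
      show "n l = n' l" if "l \<in> {1..length (p @ [i, j] @ q)}" "l \<notin> {k+1..k+length [i, j]}" for l
      proof -
        have "l \<in> {1..length ii} - {k+1, k+2}" using that unfolding eq(1)[symmetric] by auto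
        then show ?thesis using rel two by blast
      qed
      show "subword_prods (zero_letters (\<lambda>l. n (l + k)) [i, j])
          = subword_prods (zero_letters (\<lambda>l. n' (l + k)) [j, i])"
        unfolding z n' using subword_prods_commute[OF ij] by (cases "n (k+1) = 0"; cases "n (k+2) = 0") auto
    qed simp
  next
    assume three: "three_move A k ii jj"
    then obtain p q i j where p: "length p = k" and ij: "A i j = -1"
      and eq: "ii = p @ [i, j, i] @ q" "jj = p @ [j, i, j] @ q" unfolding three_move_def by blast
    define a b c where "a = n (k+1)" and "b = n (k+2)" and "c = n (k+3)"
    have n': "n' (k+1) = b + c - min a c" "n' (k+2) = min a c" "n' (k+3) = a + b - min a c"
      using rel three unfolding a_def b_def c_def by simp_all
    have z: "zero_letters (\<lambda>l. m (l + k)) [x, y, z] = (if m (k+1) = 0 then [x] else []) @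
        (if m (k+2) = 0 then [y] else []) @ (if m (k+3) = 0 then [z] else [])" for m x y z
      by (simp add: zero_letters_Cons zero_letters_Nil eval_nat_numeral)
    show "subword_prods (zero_letters n ii) = subword_prods (zero_letters n' jj)"
      unfolding eq
    proof (rule glue[OF p])
      show "n l = n' l" if "l \<in> {1..length (p @ [i, j, i] @ q)}" "l \<notin> {k+1..k+length [i, j, i]}" for l
      proof -
        have "l \<in> {1..length ii} - {k+1, k+2, k+3}" using that unfolding eq(1)[symmetric] by auto
        then show ?thesis using rel three by blast
      qed
      show "subword_prods (zero_letters (\<lambda>l. n (l + k)) [i, j, i])
          = subword_prods (zero_letters (\<lambda>l. n' (l + k)) [j, i, j])"
      proof -
        have zeros: "b + c - min a c = 0 \<longleftrightarrow> b = 0 \<and> c \<le> a" "min a c = 0 \<longleftrightarrow> a = 0 \<or> c = 0"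
            "a + b - min a c = 0 \<longleftrightarrow> b = 0 \<and> a \<le> c"
          by (auto simp: min_def)
        show ?thesis
          unfolding z n' zeros a_def[symmetric] b_def[symmetric] c_def[symmetric]
          by (cases "a = 0"; cases "b = 0"; cases "c = 0"; cases "a \<le> c"; cases "c \<le> a";
              simp add: subword_prods_braid[OF ij] subword_prods_double)
      qed
    qed simp
  qed
qed

lemma zero_prods_max:
  assumes "mv_datum A \<mu>"
  obtains d where "d \<in> weyl A"
    "\<And>ii. ii \<in> reduced_words A w0 \<Longrightarrow>
       subword_prods (zero_letters (edge_length A \<mu> ii) ii) = {u. bruhat_le A u d}"
proof -
  let ?V = "\<lambda>ii. subword_prods (zero_letters (edge_length A \<mu> ii) ii)"
  obtain jj where jj: "jj \<in> reduced_words A w0" using reduced_words_nonempty longest_weyl by blast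
  obtain d where d: "d \<in> weyl A" "?V jj = {u. bruhat_le A u d}" using subword_prods_max by blast
  have "?V jj = ?V ii" if "ii \<in> reduced_words A w0" for ii
  proof -
    have "ii \<in> reduced_words A w0 \<and> ?V jj = ?V ii" if "braid_step\<^sup>*\<^sup>* jj ii" for ii
      using that
    proof (induction rule: rtranclp_induct)
      case (step y z)
      then show ?case using braid_step_zero_prods[OF assms, of y z] braid_step_reduced[of y z] by simp
    qed (simp add: jj)
    then show ?thesis using matsumoto[OF jj that] by blast
  qed
  then show thesis using that d by metis
qed

lemma sum_coroots:
  fixes f :: "'i \<Rightarrow> real"
  shows "(\<Sum>j\<in>UNIV. f j *\<^sub>R simple_coroot j) = (\<chi> j. f j)"
  using vec_expand[of "\<chi> j. f j"] by (simp add: simple_coroot_def)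

lemma ggms_iff: "ggms_datum A \<mu> \<longleftrightarrow>
  (\<forall>w\<in>weyl A. \<forall>w'\<in>weyl A. \<exists>c :: 'i \<Rightarrow> nat. inv w (\<mu> w' - \<mu> w) = (\<chi> j. real (c j)))"
  unfolding ggms_datum_def sum_coroots ..

lemma ggms_nonneg:
  "ggms_datum A \<mu> \<Longrightarrow> w \<in> weyl A \<Longrightarrow> w' \<in> weyl A \<Longrightarrow> nonneg_vec (inv w (\<mu> w' - \<mu> w))"
  unfolding ggms_iff by (metis nonneg_vec_def of_nat_0_le_iff vec_lambda_beta)

lemma polytope_iff: "h \<in> pseudo_weyl_polytope A \<mu> \<longleftrightarrow> (\<forall>w\<in>weyl A. nonneg_vec (inv w (h - \<mu> w)))"
proof -
  have "(\<exists>c :: 'i \<Rightarrow> real. (\<forall>j. 0 \<le> c j) \<and> v = (\<chi> j. c j)) \<longleftrightarrow> nonneg_vec v" for v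
    unfolding nonneg_vec_def by (auto intro!: exI[of _ "vec_nth v"])
  then show ?thesis unfolding pseudo_weyl_polytope_def sum_coroots by simp
qed

lemma vertex_in_polytope: "ggms_datum A \<mu> \<Longrightarrow> w \<in> weyl A \<Longrightarrow> \<mu> w \<in> pseudo_weyl_polytope A \<mu>"
  by (simp add: polytope_iff ggms_nonneg)

text \<open>
  Each datum has its vertices in the common polytope, so the difference of two corresponding vertices lies in the
  cone at that vertex together with its negative, and the cone is pointed.
\<close>
lemma datum_unique:
  assumes "ggms_datum A \<mu>" "ggms_datum A \<nu>" "pseudo_weyl_polytope A \<mu> = pseudo_weyl_polytope A \<nu>"
    and w: "w \<in> weyl A"
  shows "\<mu> w = \<nu> w"
proof -
  have lin: "linear (inv w)" using w by (intro weyl_linear weyl_inv)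
  have "nonneg_vec (inv w (\<mu> w - \<nu> w))" "nonneg_vec (inv w (\<nu> w - \<mu> w))"
    using vertex_in_polytope[OF assms(1) w] vertex_in_polytope[OF assms(2) w] assms(3) w polytope_iff by metis+
  then have "inv w (\<mu> w - \<nu> w) = 0"
    using nonneg_vec_antisym[of "inv w (\<mu> w - \<nu> w)"] linear_neg[OF lin, of "\<mu> w - \<nu> w"] by simp
  then have "\<mu> w - \<nu> w = w 0" using w weyl_inv_app(2) by metis
  then show ?thesis using linear_0[OF weyl_linear[OF w]] by simp
qed

lemma edge_length_datum_of:
  assumes "ggms_datum A \<mu>" 
  shows "edge_length A (datum_of A (pseudo_weyl_polytope A \<mu>)) = edge_length A \<mu>"
proof -
  let ?\<nu> = "datum_of A (pseudo_weyl_polytope A \<mu>)"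
  have "ggms_datum A ?\<nu> \<and> pseudo_weyl_polytope A ?\<nu> = pseudo_weyl_polytope A \<mu>"
    unfolding datum_of_def by (rule someI[of _ \<mu>]) (use assms in simp)
  then have "?\<nu> w = \<mu> w" if "w \<in> weyl A" for w using datum_unique assms that by blast
  then show ?thesis unfolding edge_length_def by (simp add: weyl_word)
qed

lemma W_set_eq:
  assumes "ggms_datum A \<mu>"
  shows "W_set A (pseudo_weyl_polytope A \<mu>) ii
       = (\<lambda>u. u \<circ> w0) ` subword_prods (zero_letters (edge_length A \<mu> ii) ii)"
proof -
  have "W_set A (pseudo_weyl_polytope A \<mu>) ii = (\<lambda>r. word_prod A r \<circ> w0) `
    {subword ii as | as. as \<in> position_seqs ii \<and> (\<forall>a\<in>set as. edge_length A \<mu> ii a = 0)}"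
    unfolding W_set_def T_seqs_def edge_length_datum_of[OF assms] by blast
  then show ?thesis unfolding subwords_at_zeros subword_prods_def image_image
    by (simp add: Collect_conj_eq flip: in_set_subseqs)
qed

text \<open>
  The condition asks for a subword of length exactly \<open>len A (x \<circ> w0)\<close>; by deletion, any subword with the right
  product contains one.
\<close>
lemma demazure_cond_iff_subword:
  assumes "ggms_datum A \<mu>"
  shows "demazure_cond A x (pseudo_weyl_polytope A \<mu>) \<longleftrightarrow>
    (\<exists>ii\<in>reduced_words A w0. x \<circ> w0 \<in> subword_prods (zero_letters (edge_length A \<mu> ii) ii))"
proof -
  have len: "length (subword ii as) = length as" for ii :: "'i list" and as
    by (simp add: subword_def)
  have "(\<exists>as\<in>S_seqs A v ii. \<forall>a\<in>set as. edge_length A \<mu> ii a = 0)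
      \<longleftrightarrow> v \<in> subword_prods (zero_letters (edge_length A \<mu> ii) ii)" (is "?L \<longleftrightarrow> ?R") for ii v
  proof -
    have "?L \<longleftrightarrow> (\<exists>r \<in> {subword ii as | as. as \<in> position_seqs ii \<and> (\<forall>a\<in>set as. edge_length A \<mu> ii a = 0)}.
        length r = len A v \<and> word_prod A r = v)"
      unfolding S_seqs_def using len by auto
    also have "\<dots> \<longleftrightarrow> ?R"
    proof -
      have "\<exists>r'. subseq r' q \<and> length r' = len A v \<and> word_prod A r' = v"
        if "subseq r q" "v = word_prod A r" for r q
        using reduced_subword_exists[of r] that by (metis subseq_order.trans)
      then show ?thesis unfolding subwords_at_zeros subword_prods_iff by blast
    qed
    finally show ?thesis .
  qed
  then show ?thesis unfolding demazure_cond_def edge_length_datum_of[OF assms] by blast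
qed

lemma polytope_minimum:
  assumes "mv_datum A \<mu>"
  obtains y where "y \<in> weyl A" 
    "\<And>x. demazure_cond A x (pseudo_weyl_polytope A \<mu>) \<longleftrightarrow> bruhat_le A y x"
    "\<And>ii x. ii \<in> reduced_words A w0 \<Longrightarrow>
       is_bruhat_minimum A (W_set A (pseudo_weyl_polytope A \<mu>) ii) x \<longleftrightarrow> x = y"
    "\<And>ii. ii \<in> reduced_words A w0 \<Longrightarrow>
       subword_prods (zero_letters (edge_length A \<mu> ii) ii) = {u. bruhat_le A u (y \<circ> w0)}"
proof -
  have g: "ggms_datum A \<mu>" using assms by (simp add: mv_datum_def)
  obtain d where d: "d \<in> weyl A" and V: "\<And>ii. ii \<in> reduced_words A w0 \<Longrightarrow>
       subword_prods (zero_letters (edge_length A \<mu> ii) ii) = {u. bruhat_le A u d}"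
    using zero_prods_max[OF assms] by blast
  have ne: "\<exists>ii. ii \<in> reduced_words A w0" using reduced_words_nonempty longest_weyl by blast
  show thesis
  proof (rule that[of "d \<circ> w0"])
    show "d \<circ> w0 \<in> weyl A" using d longest_weyl by (rule weyl_comp)
    show "demazure_cond A x (pseudo_weyl_polytope A \<mu>) \<longleftrightarrow> bruhat_le A (d \<circ> w0) x" for x
      unfolding demazure_cond_iff_subword[OF g] using V ne bruhat_reverse_iff[of x d] by auto
    show "is_bruhat_minimum A (W_set A (pseudo_weyl_polytope A \<mu>) ii) x \<longleftrightarrow> x = d \<circ> w0"
      if ii: "ii \<in> reduced_words A w0" for ii x
    proof -
      have "W_set A (pseudo_weyl_polytope A \<mu>) ii = (\<lambda>u. u \<circ> w0) ` {u. bruhat_le A u d}"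
        unfolding W_set_eq[OF g] V[OF ii] ..
      then have "is_bruhat_minimum A (W_set A (pseudo_weyl_polytope A \<mu>) ii) (d \<circ> w0)"
        unfolding is_bruhat_minimum_def using bruhat_reverse by auto
      then show ?thesis unfolding is_bruhat_minimum_def using bruhat_antisym by blast
    qed
    show "subword_prods (zero_letters (edge_length A \<mu> ii) ii) = {u. bruhat_le A u (d \<circ> w0 \<circ> w0)}"
      if "ii \<in> reduced_words A w0" for ii unfolding comp_longest_longest by (rule V[OF that])
  qed
qed

text \<open>
  If the pieces \<open>D z\<close> containing \<open>P\<close> are those with \<open>y \<le> z\<close>, then removing the pieces of smaller admissible
  indices isolates \<open>y\<close>.  Here admissibility of \<open>y\<close> is essential.
\<close>
lemma in_bar_iff:
  assumes dem: "\<And>z. P \<in> D z \<longleftrightarrow> bruhat_le A y z" and "y \<in> S" 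
  shows "P \<in> D x - (\<Union>z\<in>{z \<in> S. bruhat_less A z x}. D z) \<longleftrightarrow> x = y"
  using assms bruhat_antisym unfolding bruhat_less_def by auto

section \<open>Minimal coset representatives\<close>

text \<open>
  In fact \<open>y \<le> y u\<close> for every \<open>u\<close> in the stabilizer, by induction on the length of \<open>u\<close>.  If \<open>u\<close> sends
  \<open>alpha j\<close> to \<open>- g\<close> with \<open>g\<close> positive, then \<open>\<langle>alpha j, \<lambda>\<rangle> = - \<langle>g, \<lambda>\<rangle>\<close>, so both vanish by dominance.
  Hence \<open>s_j\<close> is in the stabilizer, and \<open>g\<close> is a combination of simple roots orthogonal to \<open>\<lambda>\<close>, so that \<open>y g\<close>
  is positive and \<open>y u s_j < y u\<close>.
\<close>
lemma min_coset_repsI: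
  assumes "y \<in> weyl A" "dominant A lam"
    and desc: "\<And>j. alpha j \<bullet>\<^sub>A lam = 0 \<Longrightarrow> nonneg_vec (y (alpha j))"
  shows "y \<in> min_coset_reps A lam"
proof -
  have dom: "0 \<le> alpha j \<bullet>\<^sub>A lam" for j
    using assms(2) by (simp add: dominant_def simple_root_eq_form)
  have "bruhat_le A y (y \<circ> u)" if "u \<in> weyl A" "u lam = lam" for u
    using that
  proof (induction "len A u" arbitrary: u rule: less_induct)
    case less
    show ?case
    proof (cases "u = id")
      case False
      then obtain j where j: "\<not> nonneg_vec (u (alpha j))" using weyl_eq_id less.prems(1) by blast
      let ?g = "- u (alpha j)"
      have g: "root_vec A ?g" "nonneg_vec ?g"
        using j root_sign root_minus weyl_root[OF less.prems(1) root_alpha(1)] by blast+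
      have sum: "?g \<bullet>\<^sub>A lam = (\<Sum>i\<in>UNIV. ?g $ i * (alpha i \<bullet>\<^sub>A lam))"
        by (rule cartan_form_expand_left)
      have terms: "0 \<le> ?g $ i * (alpha i \<bullet>\<^sub>A lam)" for i
        using g(2) dom unfolding nonneg_vec_def by (metis mult_nonneg_nonneg)
      have "?g \<bullet>\<^sub>A lam = - (alpha j \<bullet>\<^sub>A lam)"
        using weyl_form[OF less.prems(1), of "alpha j" lam] less.prems(2) by (simp add: cartan_form_bilinear)
      then have zero: "alpha j \<bullet>\<^sub>A lam = 0" "?g \<bullet>\<^sub>A lam = 0"
        using dom[of j] sum terms sum_nonneg[of UNIV "\<lambda>i. ?g $ i * (alpha i \<bullet>\<^sub>A lam)"] by auto
      have "?g $ i * (alpha i \<bullet>\<^sub>A lam) = 0" for i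
        using zero(2) sum terms sum_nonneg_eq_0_iff[of UNIV "\<lambda>i. ?g $ i * (alpha i \<bullet>\<^sub>A lam)"] by simp
      then have "?g $ i = 0 \<or> nonneg_vec (y (alpha i))" for i
        using desc[of i] mult_eq_0_iff by metis
      then have "nonneg_vec (y ?g)" using weyl_nonneg_comb assms(1) g(2) by blast
      then have "nonneg_vec (- (y \<circ> u) (alpha j))" using assms(1) by (simp add: weyl_minus)
      then have "\<not> nonneg_vec ((y \<circ> u) (alpha j))"
        using root_sign weyl_root[OF weyl_comp[OF assms(1) less.prems(1)] root_alpha(1)] by blast
      then have down: "bruhat_le A (y \<circ> u \<circ> refl j) (y \<circ> u)"
        using bruhat_refl_down weyl_comp[OF assms(1) less.prems(1)] by blast
      have "refl j lam = lam" using zero(1) by (simp add: simple_refl_eq_reflect reflect_def)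
      then have "bruhat_le A y (y \<circ> (u \<circ> refl j))"
        using less.prems len_refl_down[OF less.prems(1) j] comp_refl_weyl
        by (intro less.hyps) auto
      then show ?thesis using bruhat_trans down unfolding comp_assoc by blast
    qed simp
  qed
  then show ?thesis
    using assms(1) bruhat_antisym unfolding min_coset_reps_def stabilizer_def bruhat_less_def by blast
qed

lemma convex_sublevel: "convex {v. v \<bullet>\<^sub>A v \<le> c}"
proof (rule convexI)
  fix u v :: "real ^ 'i" and a b :: real
  assume uv: "u \<in> {v. v \<bullet>\<^sub>A v \<le> c}" "v \<in> {v. v \<bullet>\<^sub>A v \<le> c}" and ab: "0 \<le> a" "0 \<le> b" "a + b = 1"
  have b: "b = 1 - a" using ab by simp
  let ?w = "a *\<^sub>R u + b *\<^sub>R v"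
  have "?w \<bullet>\<^sub>A ?w = a * (u \<bullet>\<^sub>A u) + b * (v \<bullet>\<^sub>A v) - a * b * ((u - v) \<bullet>\<^sub>A (u - v))"
    using form_commute[of v u] unfolding b by (simp add: cartan_form_bilinear algebra_simps)
  moreover have "0 \<le> (u - v) \<bullet>\<^sub>A (u - v)"
    using form_pos[of "u - v"] by (cases "u = v") (auto simp: cartan_form_def)
  then have "0 \<le> a * b * ((u - v) \<bullet>\<^sub>A (u - v))" using ab by simp
  moreover have "a * (u \<bullet>\<^sub>A u) + b * (v \<bullet>\<^sub>A v) \<le> a * c + b * c"
    using uv ab by (intro add_mono mult_left_mono) auto
  moreover have "a * c + b * c = c" unfolding b by (simp add: algebra_simps)
  ultimately show "?w \<in> {v. v \<bullet>\<^sub>A v \<le> c}" unfolding mem_Collect_eq by linarith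
qed

lemma orbit_hull_norm:
  assumes "v \<in> convex hull {w lam | w. w \<in> weyl A}"
  shows "v \<bullet>\<^sub>A v \<le> lam \<bullet>\<^sub>A lam"
proof -
  have "convex hull {w lam | w. w \<in> weyl A} \<subseteq> {v. v \<bullet>\<^sub>A v \<le> lam \<bullet>\<^sub>A lam}"
    by (rule hull_minimal) (auto simp: weyl_form convex_sublevel)
  then show ?thesis using assms by blast
qed

text \<open>
  The last edge starts at \<open>\<lambda> - n h_j\<close> for some \<open>n \<ge> 0\<close>.  As \<open>\<lambda>\<close> is orthogonal to \<open>alpha j\<close>, this point has
  squared norm \<open>|\<lambda>|\<^sup>2 + 2 n\<^sup>2\<close>, which exceeds the maximum on the orbit hull unless \<open>n = 0\<close>.
\<close>
lemma last_edge_zero: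
  assumes g: "ggms_datum A \<mu>" and lam: "\<mu> w0 = lam"
    and sub: "pseudo_weyl_polytope A \<mu> \<subseteq> convex hull {w lam | w. w \<in> weyl A}"
    and orth: "alpha j \<bullet>\<^sub>A lam = 0"
    and i: "w0 (alpha i) = - alpha j"
    and red: "r @ [i] \<in> reduced_words A w0"
  shows "edge_length A \<mu> (r @ [i]) (Suc (length r)) = 0"
proof -
  let ?w = "w0 \<circ> refl i"
  have w: "?w \<in> weyl A" using comp_refl_weyl longest_weyl by blast
  define C where "C = inv w0 (\<mu> ?w - \<mu> w0)"
  have C: "nonneg_vec C" unfolding C_def using g longest_weyl w by (rule ggms_nonneg)
  have \<mu>w: "\<mu> ?w = lam + w0 C" unfolding C_def lam using longest_weyl by simp
  have "?w (refl i (- C)) = \<mu> w0 - \<mu> ?w"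
    using longest_weyl by (simp add: \<mu>w lam weyl_minus)
  then have "inv ?w (\<mu> w0 - \<mu> ?w) = refl i (- C)" using weyl_inv_app(1)[OF w] by metis
  then have C': "nonneg_vec (refl i (- C))" using ggms_nonneg[OF g w longest_weyl] by simp
  \<comment> \<open>The conditions at the two ends of the edge force the edge to be parallel to the root
    w0 (alpha i): away from i, the reflection only changes the sign of C.\<close>
  have "C $ k = 0" if "k \<noteq> i" for k
    using C C' refl_coord[OF that, of "- C"] unfolding nonneg_vec_def
    by (metis neg_0_le_iff_le order_antisym uminus_vec_def vector_uminus_component)
  then have "w0 C = C $ i *\<^sub>R w0 (alpha i)"
    using weyl_expand[OF longest_weyl, of C] sum.remove[of UNIV i "\<lambda>k. C $ k *\<^sub>R w0 (alpha k)"] by simp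
  then have \<mu>w': "\<mu> ?w = lam - C $ i *\<^sub>R alpha j" using \<mu>w i by simp
  have "\<mu> ?w \<bullet>\<^sub>A \<mu> ?w \<le> lam \<bullet>\<^sub>A lam"
    using vertex_in_polytope[OF g w] sub orbit_hull_norm by blast
  then have "C $ i * (C $ i) \<le> 0"
    unfolding \<mu>w' using orth form_commute[of lam "alpha j"]
    by (simp add: cartan_form_bilinear cartan_form_axis diag)
  then have "C $ i = 0" using not_real_square_gt_zero by (metis not_less)
  then have eq: "\<mu> w0 - \<mu> ?w = 0" using \<mu>w' lam by simp
  have prods: "word_prod A (r @ [i]) = w0" "word_prod A r = ?w"
    using reduced_wordsD(1)[OF red] reduced_wordsD(1)[OF reduced_snoc(1)[OF red]] by blast+
  have "?w (alpha i) = alpha j"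
    using i longest_weyl by (simp add: simple_refl_eq_reflect reflect_self root_alpha weyl_minus)
  then show ?thesis
    unfolding edge_length_def using eq prods
    by (intro the_equality) (auto simp: axis_eq_0_iff simple_coroot_def)
qed

text \<open>
  Take a reduced word ending in the letter \<open>i\<close> with \<open>w0 (alpha i) = - alpha j\<close>.  Its last edge vanishes, so the
  subword products are stable under right multiplication by \<open>s_i\<close>.  Their maximum \<open>y w0\<close> thus has
  the right descent \<open>i\<close>, which means that \<open>y (alpha j)\<close> is positive.
\<close>
lemma minimum_in_min_coset_reps:
  assumes mv: "mv_datum A \<mu>" and lam: "\<mu> w0 = lam" "dominant A lam"
    and sub: "pseudo_weyl_polytope A \<mu> \<subseteq> convex hull {w lam | w. w \<in> weyl A}"
    and y: "y \<in> weyl A"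
    and V: "\<And>ii. ii \<in> reduced_words A w0 \<Longrightarrow>
       subword_prods (zero_letters (edge_length A \<mu> ii) ii) = {u. bruhat_le A u (y \<circ> w0)}"
  shows "y \<in> min_coset_reps A lam"
proof (rule min_coset_repsI[OF y lam(2)])
  fix j assume orth: "alpha j \<bullet>\<^sub>A lam = 0"
  obtain i where i: "w0 (alpha i) = - alpha j" "w0 (alpha j) = - alpha i"
    using longest_permutes_simple .
  obtain r where "r \<in> reduced_words A (w0 \<circ> refl i)"
    using reduced_words_nonempty comp_refl_weyl longest_weyl by blast
  then have red: "r @ [i] \<in> reduced_words A w0"
    using reduced_snocI longest_weyl longest_alpha by blast
  let ?n = "edge_length A \<mu> (r @ [i])"
  have "?n (Suc (length r)) = 0"
    using last_edge_zero[OF _ lam(1) sub orth i(1) red] mv by (simp add: mv_datum_def)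
  then have "zero_letters ?n (r @ [i]) = zero_letters ?n r @ [i]"
    by (simp add: zero_letters_append zero_letters_Cons zero_letters_Nil)
  then have "subword_prods (zero_letters ?n r) \<union> (\<lambda>u. u \<circ> refl i) ` subword_prods (zero_letters ?n r)
      = {u. bruhat_le A u (y \<circ> w0)}"
    using V[OF red] by (simp add: subword_prods_snoc)
  moreover have "y \<circ> w0 \<in> {u. bruhat_le A u (y \<circ> w0)}" by simp
  ultimately have "y \<circ> w0 \<circ> refl i \<in> {u. bruhat_le A u (y \<circ> w0)}"
    using comp_refl_refl by (smt (verit) Un_iff image_iff)
  then have "\<not> len A (y \<circ> w0) < len A (y \<circ> w0 \<circ> refl i)"
    using bruhat_le_len by fastforce
  then have "\<not> nonneg_vec ((y \<circ> w0) (alpha i))"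
    using len_refl_iff[OF weyl_comp[OF y longest_weyl]] by blast
  then show "nonneg_vec (y (alpha j))"
    using i y root_sign[OF weyl_root[OF y root_alpha(1)]] by (auto simp: weyl_minus)
qed

section \<open>Demazure strata\<close>

lemma MV_bar_iff:
  assumes "dominant A lam" "P \<in> MV A lam" "x \<in> min_coset_reps A lam" "ii \<in> reduced_words A w0"
  shows "P \<in> MV_bar A x lam \<longleftrightarrow> is_bruhat_minimum A (W_set A P ii) x"
proof -
  obtain \<mu> where P: "P = pseudo_weyl_polytope A \<mu>" and mv: "mv_datum A \<mu>" "\<mu> w0 = lam"
    and sub: "pseudo_weyl_polytope A \<mu> \<subseteq> convex hull {w lam | w. w \<in> weyl A}"
    using assms(2) unfolding MV_def by blast
  obtain y where y: "y \<in> weyl A" "\<And>x. demazure_cond A x P \<longleftrightarrow> bruhat_le A y x"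
    "\<And>ii x. ii \<in> reduced_words A w0 \<Longrightarrow> is_bruhat_minimum A (W_set A P ii) x \<longleftrightarrow> x = y"
    "\<And>ii. ii \<in> reduced_words A w0 \<Longrightarrow>
       subword_prods (zero_letters (edge_length A \<mu> ii) ii) = {u. bruhat_le A u (y \<circ> w0)}"
    by (rule polytope_minimum[OF mv(1), folded P]) (rule that)
  have "y \<in> min_coset_reps A lam"
    using minimum_in_min_coset_reps[OF mv assms(1) sub y(1,4)] by blast
  then show ?thesis unfolding MV_bar_def y(3)[OF assms(4)]
    using assms(2) y(2) by (intro in_bar_iff) (auto simp: MV_dem_def)
qed

lemma MV_inf_bar_iff:
  assumes "P \<in> MV_inf A" "ii \<in> reduced_words A w0"
  shows "P \<in> MV_inf_bar A x \<longleftrightarrow> is_bruhat_minimum A (W_set A P ii) x"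
proof -
  obtain \<mu> where P: "P = pseudo_weyl_polytope A \<mu>" and mv: "mv_datum A \<mu>"
    using assms(1) unfolding MV_inf_def by blast
  obtain y where y: "y \<in> weyl A" "\<And>x. demazure_cond A x P \<longleftrightarrow> bruhat_le A y x"
    "\<And>ii x. ii \<in> reduced_words A w0 \<Longrightarrow> is_bruhat_minimum A (W_set A P ii) x \<longleftrightarrow> x = y"
    by (rule polytope_minimum[OF mv, folded P]) (rule that)
  then show ?thesis unfolding MV_inf_bar_def y(3)[OF assms(2)]
    using assms(1) by (intro in_bar_iff) (auto simp: MV_inf_dem_def)
qed

end

theorem proposition5p1p4:
  fixes A :: "'i::finite \<Rightarrow> 'i \<Rightarrow> int" and X :: "(real ^ 'i) set" and lam :: "real ^ 'i"
  assumes "simply_laced_root_datum A X"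
    and "lam \<in> X" and "dominant A lam"
  shows "(\<forall>P\<in>MV A lam. \<forall>x\<in>min_coset_reps A lam.
            (P \<in> MV_bar A x lam \<longleftrightarrow>
               (\<exists>ii\<in>reduced_words A (longest A). is_bruhat_minimum A (W_set A P ii) x)) \<and>
            (P \<in> MV_bar A x lam \<longleftrightarrow>
               (\<forall>ii\<in>reduced_words A (longest A). is_bruhat_minimum A (W_set A P ii) x)))
       \<and> (\<forall>P\<in>MV_inf A. \<forall>x\<in>weyl A.
            (P \<in> MV_inf_bar A x \<longleftrightarrow>
               (\<exists>ii\<in>reduced_words A (longest A). is_bruhat_minimum A (W_set A P ii) x)) \<and>
            (P \<in> MV_inf_bar A x \<longleftrightarrow>
               (\<forall>ii\<in>reduced_words A (longest A). is_bruhat_minimum A (W_set A P ii) x)))"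
proof -
  interpret simply_laced A
    using assms(1) by unfold_locales (simp add: simply_laced_root_datum_def)
  have "\<exists>ii. ii \<in> reduced_words A (longest A)"
    using reduced_words_nonempty longest_weyl by blast
  then show ?thesis using MV_bar_iff[OF assms(3)] MV_inf_bar_iff by blast
qed

end
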